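(* Let $\Gamma$ be a limit cycle of $\dot u=F(u)$ at a strong resonance 1:1 (R1) bifurcation, with the critical center manifold near $\Gamma$ parametrized by $(\tau,\xi_1,\xi_2)$ as in the context, so that the restricted dynamics has the R1 periodic normal form with coefficients $\alpha,a,b$. Let $v_1,v_2,\varphi^*,v_1^*$ be as in the context. Then $$a=\frac12\int_0^T\langle\varphi^*,2A(\tau)v_1+B(\tau;v_1,v_1)\rangle d\tau$$ and $$b=\int_0^T\langle\varphi^*,B(\tau;v_1,v_2)+A(\tau)v_2\rangle d\tau+\int_0^T\langle v_1^*,2A(\tau)v_1+B(\tau;v_1,v_1)\rangle d\tau .$$
   Context: Setting. $F:\mathbb R^n\to\mathbb R^n$ is sufficiently smooth and $u_0$ is a nonconstant periodic solution of $\dot u=F(u)$ with minimal period $T>0$; $\Gamma$ is its orbit. $A(\tau)=F_u(u_0(\tau))$ and $B(\tau;\cdot,\cdot)$ is the symmetric bilinear form of second derivatives of $F$ at $u_0(\tau)$. Dots over functions of $\tau$ denote $d/d\tau$; $\langle a,b\rangle=a^{\rm T}b$. Let $Y$ solve $\dot Y=A(\tau)Y$, $Y(0)=I_n$; the eigenvalues of $Y(T)$ are the multipliers, critical if of modulus 1. R1 bifurcation: the multiplier $1$ corresponds to a three-dimensional Jordan block (algebraic multiplicity 3), and there are no other critical multipliers. The three-dimensional critical center manifold near $\Gamma$ is parametrized as $u=u_0(\tau)+\xi_1v_1(\tau)+\xi_2v_2(\tau)+H(\tau,\xi)$, $\xi=(\xi_1,\xi_2)\in\mathbb R^2$ small,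 $H$ smooth and $T$-periodic in $\tau$, $H=\frac12h_{20}\xi_1^2+h_{11}\xi_1\xi_2+\frac12h_{02}\xi_2^2+O(\|\xi\|^3)$. The dynamics restricted to it is $$\frac{d\tau}{dt}=1-\xi_1+\alpha\xi_1^2+\dots,\quad\frac{d\xi_1}{dt}=\xi_2+\xi_1\xi_2+\dots,\quad\frac{d\xi_2}{dt}=a\xi_1^2+b\xi_1\xi_2+\dots,$$ with real $\alpha,a,b$ and dots denoting $O(\|\xi\|^3)$ terms $T$-periodic in $\tau$; that is, if $(\tau(t),\xi(t))$ solves this system then $u(\tau(t),\xi(t))$ solves $\dot u=F(u)$. The following are on $[0,T]$ with $T$-periodic boundary conditions: $\dot v_1-A v_1-F(u_0)=0$, $v_1(T)=v_1(0)$, $\int_0^T\langle v_1,F(u_0)\rangle d\tau=0$; $\dot v_2-Av_2+v_1=0$, $v_2(T)=v_2(0)$, $\int_0^T\langle v_2,F(u_0)\rangle d\tau=0$; $\dot\varphi^*+A^{\rm T}\varphi^*=0$, $\varphi^*(T)=\varphi^*(0)$, $\int_0^T\langle\varphi^*,v_2\rangle d\tau=1$; $\dot v_1^*+A^{\rm T}v_1^*-\varphi^*=0$, $v_1^*(T)=v_1^*(0)$, $\int_0^T\langle v_1^*,v_2\rangle d\tau=0$. *)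

theory Defs
  imports
    "HOL-Analysis.Analysis"
    "HOL-Computational_Algebra.Polynomial"
    "HOL-Library.Landau_Symbols"
begin

text \<open>\<open>C_on k f S\<close> says that \<open>f\<close> is \<open>k\<close> times continuously differentiable on \<open>S\<close>. It is meant for
  open \<open>S\<close> and a finite-dimensional domain, where continuity of all iterated directional
  derivatives is continuity of the iterated Frechet derivatives.\<close>

primrec C_on :: "nat \<Rightarrow> ('a::euclidean_space \<Rightarrow> 'b::real_normed_vector) \<Rightarrow> 'a set \<Rightarrow> bool" where
  "C_on 0 f S \<longleftrightarrow> continuous_on S f"
| "C_on (Suc k) f S \<longleftrightarrow>
     (\<forall>x\<in>S. f differentiable (at x)) \<and> (\<forall>v. C_on k (\<lambda>x. frechet_derivative f (at x) v) S)"

definition Jac :: "(real^'n \<Rightarrow> real^'n) \<Rightarrow> (real \<Rightarrow> real^'n) \<Rightarrow> real \<Rightarrow> real^'n^'n" where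
  "Jac F u0 \<tau> = jacobian F (at (u0 \<tau>))"

definition Hess ::
  "(real^'n \<Rightarrow> real^'n) \<Rightarrow> (real \<Rightarrow> real^'n) \<Rightarrow> real \<Rightarrow> real^'n \<Rightarrow> real^'n \<Rightarrow> real^'n" where
  "Hess F u0 \<tau> p q = frechet_derivative (\<lambda>u. frechet_derivative F (at u) p) (at (u0 \<tau>)) q"

definition limit_cycle :: "(real^'n \<Rightarrow> real^'n) \<Rightarrow> (real \<Rightarrow> real^'n) \<Rightarrow> real \<Rightarrow> bool" where
  "limit_cycle F u0 T \<longleftrightarrow>
     (\<forall>t. (u0 has_vector_derivative F (u0 t)) (at t)) \<and>
     \<not> (\<exists>c. \<forall>t. u0 t = c) \<and>
     0 < T \<and> (\<forall>t. u0 (t + T) = u0 t) \<and>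
     (\<forall>s. 0 < s \<and> s < T \<longrightarrow> (\<exists>t. u0 (t + s) \<noteq> u0 t))"

definition fundamental_solution :: "(real \<Rightarrow> real^'n^'n) \<Rightarrow> (real \<Rightarrow> real^'n^'n) \<Rightarrow> bool" where
  "fundamental_solution A Y \<longleftrightarrow>
     (\<forall>t. (Y has_vector_derivative A t ** Y t) (at t)) \<and> Y 0 = mat 1"

definition eigenvalues :: "'a::field^'n^'n \<Rightarrow> 'a set" where
  "eigenvalues M = {\<mu>. \<exists>x. x \<noteq> 0 \<and> M *v x = \<mu> *s x}"

definition charpoly :: "'a::field^'n^'n \<Rightarrow> 'a poly" where
  "charpoly M = det (mat [:0, 1:] - map_matrix (\<lambda>c. [:c:]) M)"

text \<open>The eigenvalue \<open>\<mu>\<close> has algebraic multiplicity \<open>k\<close> and a Jordan chain \<open>x 1, \<dots>, x k\<close>, so that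
  the part of the Jordan form of \<open>M\<close> belonging to \<open>\<mu>\<close> is one \<open>k\<close>-dimensional block.\<close>

definition single_Jordan_block :: "'a::field^'n^'n \<Rightarrow> 'a \<Rightarrow> nat \<Rightarrow> bool" where
  "single_Jordan_block M \<mu> k \<longleftrightarrow>
     order \<mu> (charpoly M) = k \<and>
     (\<exists>x :: nat \<Rightarrow> 'a^'n. x 0 = 0 \<and> x 1 \<noteq> 0 \<and>
        (\<forall>i<k. M *v x (Suc i) = \<mu> *s x (Suc i) + x i))"

definition R1_bifurcation :: "real^'n^'n \<Rightarrow> bool" where
  "R1_bifurcation monodromy \<longleftrightarrow>
     (let M = map_matrix complex_of_real monodromy in
        single_Jordan_block M 1 3 \<and> (\<forall>\<mu>\<in>eigenvalues M. cmod \<mu> = 1 \<longrightarrow> \<mu> = 1))"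

definition periodic_bvp ::
  "real \<Rightarrow> (real \<Rightarrow> real^'n \<Rightarrow> real^'n) \<Rightarrow> (real \<Rightarrow> real^'n) \<Rightarrow> bool" where
  "periodic_bvp T g y \<longleftrightarrow>
     (\<forall>t\<in>{0..T}. (y has_vector_derivative g t (y t)) (at t within {0..T})) \<and> y T = y 0"

text \<open>The manifold parametrized by \<open>\<tau>\<close> and \<open>\<xi> = (\<xi>\<^sub>1, \<xi>\<^sub>2)\<close>, with \<open>norm \<xi> < \<delta>\<close>, carries the
  R1 periodic normal form; \<open>r0\<close>, \<open>r1\<close>, \<open>r2\<close> are the higher order terms of the restricted system,
  and \<open>v1\<close>, \<open>v2\<close> are used in their \<open>T\<close>-periodic extension to the line. That the parametrization
  maps solutions of the restricted system to solutions of \<open>u' = F u\<close> is required on every open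
  time interval on which the former stay in the domain.\<close>

definition R1_center_manifold ::
  "(real^'n \<Rightarrow> real^'n) \<Rightarrow> (real \<Rightarrow> real^'n) \<Rightarrow> real \<Rightarrow> (real \<Rightarrow> real^'n) \<Rightarrow> (real \<Rightarrow> real^'n) \<Rightarrow>
   real \<Rightarrow> real \<Rightarrow> real \<Rightarrow> bool" where
  "R1_center_manifold F u0 T v1 v2 \<alpha> a b \<longleftrightarrow>
     (\<forall>\<tau>. v1 (\<tau> + T) = v1 \<tau> \<and> v2 (\<tau> + T) = v2 \<tau>) \<and>
     (\<exists>(\<delta>::real) (H :: real \<Rightarrow> real \<times> real \<Rightarrow> real^'n)
        (h20 :: real \<Rightarrow> real^'n) (h11 :: real \<Rightarrow> real^'n) (h02 :: real \<Rightarrow> real^'n)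
        (r0 :: real \<Rightarrow> real \<times> real \<Rightarrow> real) (r1 :: real \<Rightarrow> real \<times> real \<Rightarrow> real)
        (r2 :: real \<Rightarrow> real \<times> real \<Rightarrow> real).
        0 < \<delta> \<and>
        C_on 3 (\<lambda>(\<tau>, \<xi>). H \<tau> \<xi>) (UNIV \<times> ball 0 \<delta>) \<and>
        (\<forall>\<tau>. \<forall>\<xi>\<in>ball 0 \<delta>. H (\<tau> + T) \<xi> = H \<tau> \<xi>) \<and>
        (\<forall>\<tau>. (\<lambda>\<xi>. norm (H \<tau> \<xi>
                 - ((fst \<xi>)\<^sup>2 / 2) *\<^sub>R h20 \<tau>
                 - (fst \<xi> * snd \<xi>) *\<^sub>R h11 \<tau>
                 - ((snd \<xi>)\<^sup>2 / 2) *\<^sub>R h02 \<tau>))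
              \<in> O[nhds 0](\<lambda>\<xi>. norm \<xi> ^ 3)) \<and>
        (\<forall>r\<in>{r0, r1, r2}.
           C_on 1 (\<lambda>(\<tau>, \<xi>). r \<tau> \<xi>) (UNIV \<times> ball 0 \<delta>) \<and>
           (\<forall>\<tau>. \<forall>\<xi>\<in>ball 0 \<delta>. r (\<tau> + T) \<xi> = r \<tau> \<xi>) \<and>
           (\<forall>\<tau>. r \<tau> \<in> O[nhds 0](\<lambda>\<xi>. norm \<xi> ^ 3))) \<and>
        (\<forall>p q (\<tau> :: real \<Rightarrow> real) (\<xi>1 :: real \<Rightarrow> real) (\<xi>2 :: real \<Rightarrow> real).
           (\<forall>t\<in>{p<..<q}.
              (\<xi>1 t, \<xi>2 t) \<in> ball 0 \<delta> \<and>
              (\<tau> has_real_derivative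
                 1 - \<xi>1 t + \<alpha> * (\<xi>1 t)\<^sup>2 + r0 (\<tau> t) (\<xi>1 t, \<xi>2 t)) (at t) \<and>
              (\<xi>1 has_real_derivative
                 \<xi>2 t + \<xi>1 t * \<xi>2 t + r1 (\<tau> t) (\<xi>1 t, \<xi>2 t)) (at t) \<and>
              (\<xi>2 has_real_derivative
                 a * (\<xi>1 t)\<^sup>2 + b * (\<xi>1 t * \<xi>2 t) + r2 (\<tau> t) (\<xi>1 t, \<xi>2 t)) (at t))
           \<longrightarrow>
           (let u = (\<lambda>t. u0 (\<tau> t) + \<xi>1 t *\<^sub>R v1 (\<tau> t) + \<xi>2 t *\<^sub>R v2 (\<tau> t)
                          + H (\<tau> t) (\<xi>1 t, \<xi>2 t))
            in \<forall>t\<in>{p<..<q}. (u has_vector_derivative F (u t)) (at t))))"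

end

theory Submission
  imports Defs
begin

text \<open>The parametrization intertwines the restricted flow with the flow of \<open>F\<close>. Since through every
  point of the chart there passes a solution of the restricted system, differentiating along it gives
  the homological equation pointwise. On a ray \<open>\<xi> = s w\<close> the homological equation divided by \<open>s\<^sup>2\<close>
  has a limit as \<open>s \<rightarrow> 0\<close>, and \<open>w = (1, 0), (1, 1), (1, -1)\<close> yield the linear periodic equations
  \<open>h20' - A h20 = B(v1, v1) + 2 A v1 + (2 - 2 \<alpha>) F(u0) - 2 a v2\<close> and
  \<open>h11' - A h11 = B(v1, v2) + A v2 - 2 v1 - h20 - b v2\<close>. Pairing them with the adjoint solutions is
  the Fredholm solvability condition. The unknown \<open>\<integral> \<langle>\<phi>s, h20\<rangle>\<close> it leaves in \<open>b\<close>
  is evaluated by pairing the first equation with \<open>v1s\<close>. The orthogonality relations needed on the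
  way come from pairing the equations of \<open>v1\<close> and \<open>v2\<close> with the same adjoint solutions.\<close>

section \<open>Local existence for ordinary differential equations\<close>

text \<open>Banach's fixed point theorem for the integral operator of the equation. The interval
  reaches to both sides of time 0, because the homological equation is read off from a two-sided
  derivative there.\<close>

lemma Picard_Lindelof_global:
  fixes f :: "'a::euclidean_space \<Rightarrow> 'a"
  assumes lip: "L-lipschitz_on UNIV f"
  obtains h x where "0 < h" "x 0 = x0"
    "\<And>t. t \<in> {-h<..<h} \<Longrightarrow> (x has_vector_derivative f (x t)) (at t)"
proof -
  have L0: "0 \<le> L" using lip by (rule lipschitz_on_nonneg)
  \<comment> \<open>Two integrals based at \<open>-h\<close> are subtracted in \<open>P\<close>, of
    lengths at most \<open>2 * h\<close> and \<open>h\<close>, so the contraction constant is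
    \<open>3 * h * L\<close>. Adding 1 to \<open>L\<close> covers \<open>L = 0\<close>.\<close>
  define h where "h = 1 / (6 * (L + 1))"
  have h0: "0 < h" using L0 by (simp add: h_def)
  have hL: "3 * h * L \<le> 1 / 2" using L0 by (simp add: h_def field_simps)
  \<comment> \<open>Clamping time to \<open>{-h..h}\<close> lets the fixed point live in the complete space of bounded continuous
    functions on the whole line.\<close>
  define c where "c = (\<lambda>t. max (-h) (min h t))"
  have c: "c t \<in> {-h..h}" for t using h0 by (auto simp: c_def)
  have contc: "continuous_on UNIV c" unfolding c_def by (intro continuous_intros)
  have contf: "continuous_on UNIV f" using lip by (rule lipschitz_on_continuous_on)
  \<comment> \<open>This is \<open>x0\<close> plus the integral of \<open>f (x s)\<close> from 0 to
    \<open>c t\<close>. It is written with base point \<open>-h\<close> because the integral over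
    \<open>{0..t}\<close> would be 0 for every negative \<open>t\<close>.\<close>
  define P where "P = (\<lambda>(x :: real \<Rightarrow>\<^sub>C 'a) t.
    x0 + integral {-h..c t} (\<lambda>s. f (x s)) - integral {-h..0} (\<lambda>s. f (x s)))"
  have contfx: "continuous_on S (\<lambda>s. f (apply_bcontfun x s))" for x :: "real \<Rightarrow>\<^sub>C 'a" and S
    using continuous_on_compose2[OF contf continuous_on_apply_bcontfun[of S x]] by auto
  have intgr: "(\<lambda>s. f (apply_bcontfun x s)) integrable_on {p..q}" for x :: "real \<Rightarrow>\<^sub>C 'a" and p q
    by (rule integrable_continuous_real) (rule contfx)
  have contI: "continuous_on {-h..h} (\<lambda>r. integral {-h..r} (\<lambda>s. f (apply_bcontfun x s)))" for x
    by (rule indefinite_integral_continuous_1) (rule intgr)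
  have contIc: "continuous_on UNIV (\<lambda>t. integral {-h..c t} (\<lambda>s. f (apply_bcontfun x s)))" for x
    by (rule continuous_on_compose2[OF contI contc]) (use c in auto)
  have P_bcont: "P x \<in> bcontfun" for x
  proof -
    have "continuous_on UNIV (P x)"
      unfolding P_def by (intro continuous_intros contIc)
    moreover have "bounded (range (P x))"
    proof (rule bounded_subset)
      show "bounded ((\<lambda>r. x0 + integral {-h..r} (\<lambda>s. f (x s)) - integral {-h..0} (\<lambda>s. f (x s))) ` {-h..h})"
        by (intro compact_imp_bounded compact_continuous_image continuous_intros contI compact_Icc)
    qed (use c in \<open>auto simp: P_def\<close>)
    ultimately show ?thesis by (simp add: bcontfun_def)
  qed
  have contr: "dist (Bcontfun (P x)) (Bcontfun (P y)) \<le> 1 / 2 * dist x y" for x y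
  proof (rule dist_bound)
    fix t
    have bd: "norm (integral {-h..r} (\<lambda>s. f (x s) - f (y s))) \<le> L * dist x y * (r - (-h))"
      if "r \<ge> -h" for r
    proof (rule integral_bound)
      show "continuous_on {-h..r} (\<lambda>s. f (x s) - f (y s))"
        by (intro continuous_intros contfx)
      fix s
      have "norm (f (x s) - f (y s)) \<le> L * dist (x s) (y s)"
        using lipschitz_onD[OF lip, of "x s" "y s"] by (simp add: dist_norm)
      also have "\<dots> \<le> L * dist x y" by (intro mult_left_mono dist_bounded L0)
      finally show "norm (f (x s) - f (y s)) \<le> L * dist x y" .
    qed (use that in auto)
    have "dist (P x t) (P y t) = norm (integral {-h..c t} (\<lambda>s. f (x s) - f (y s))
        - integral {-h..0} (\<lambda>s. f (x s) - f (y s)))"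
      by (simp add: P_def dist_norm integral_diff intgr algebra_simps)
    also have "\<dots> \<le> L * dist x y * (c t - (-h)) + L * dist x y * (0 - (-h))"
      using bd[of "c t"] bd[of 0] c[of t] h0 by (intro order_trans[OF norm_triangle_ineq4] add_mono) auto
    also have "\<dots> \<le> L * dist x y * (2 * h) + L * dist x y * h"
      using c[of t] L0 by (intro add_mono mult_left_mono) auto
    also have "\<dots> = (3 * h * L) * dist x y" by (simp add: algebra_simps)
    also have "\<dots> \<le> 1 / 2 * dist x y" by (intro mult_right_mono hL) auto
    finally show "dist (Bcontfun (P x) t) (Bcontfun (P y) t) \<le> 1 / 2 * dist x y"
      by (simp add: Bcontfun_inverse P_bcont)
  qed
  obtain x where x: "Bcontfun (P x) = x"
    using banach_fix_type[of "1/2" "\<lambda>x. Bcontfun (P x)"] contr by auto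
  have xP: "apply_bcontfun x t = P x t" for t
    using P_bcont[of x] x by (metis Bcontfun_inverse)
  show thesis
  proof
    show "apply_bcontfun x 0 = x0" using h0 by (simp add: xP) (simp add: P_def c_def)
    fix t assume t: "t \<in> {-h<..<h}"
    have "((\<lambda>r. integral {-h..r} (\<lambda>s. f (x s))) has_vector_derivative f (x t)) (at t within {-h..h})"
      by (rule integral_has_vector_derivative[OF contfx]) (use t in auto)
    then have "((\<lambda>r. integral {-h..r} (\<lambda>s. f (x s))) has_vector_derivative f (x t)) (at t)"
      using t by (simp add: at_within_interior[of t "{-h..h}"])
    then have "((\<lambda>r. x0 + integral {-h..r} (\<lambda>s. f (x s)) - integral {-h..0} (\<lambda>s. f (x s)))
        has_vector_derivative f (x t)) (at t)"
      by (auto intro!: derivative_eq_intros)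
    then show "(apply_bcontfun x has_vector_derivative f (apply_bcontfun x t)) (at t)"
    proof (rule has_vector_derivative_transform_within_open[where S = "{-h<..<h}"])
      fix r assume "r \<in> {-h<..<h}"
      then show "x0 + integral {-h..r} (\<lambda>s. f (x s)) - integral {-h..0} (\<lambda>s. f (x s)) = apply_bcontfun x r"
        using xP[of r] by (simp add: P_def c_def)
    qed (use t in auto)
  qed (rule h0)
qed

lemma Picard_Lindelof_local:
  fixes f :: "'a::euclidean_space \<Rightarrow> 'a"
  assumes lip: "L-lipschitz_on (cball x0 e) f" and e: "0 < e"
  obtains h x where "0 < h" "x 0 = x0"
    "\<And>t. t \<in> {-h<..<h} \<Longrightarrow> x t \<in> cball x0 e"
    "\<And>t. t \<in> {-h<..<h} \<Longrightarrow> (x has_vector_derivative f (x t)) (at t)"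
proof -
  \<comment> \<open>Composed with the nonexpansive projection onto the ball, \<open>f\<close> becomes globally Lipschitz.\<close>
  let ?c = "closest_point (cball x0 e)"
  have ne: "cball x0 e \<noteq> {}" using e by auto
  have "1-lipschitz_on UNIV ?c"
    by (rule lipschitz_onI) (use closest_point_lipschitz[OF convex_cball closed_cball ne] in auto)
  moreover have "?c ` UNIV \<subseteq> cball x0 e" using closest_point_in_set[OF closed_cball ne] by auto
  then have "L-lipschitz_on (?c ` UNIV) f" using lip lipschitz_on_subset by blast
  ultimately have "(L * 1)-lipschitz_on UNIV (\<lambda>y. f (?c y))"
    by (rule lipschitz_on_compose2)
  from Picard_Lindelof_global[OF this, of x0] obtain h x where hx: "0 < h" "x 0 = x0"
    "\<And>t. t \<in> {-h<..<h} \<Longrightarrow> (x has_vector_derivative f (?c (x t))) (at t)" by blast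
  \<comment> \<open>For short times the solution of the modified equation stays in the ball, where
    the projection is the identity, so it solves the original equation.\<close>
  have "isCont x 0" using hx(3)[of 0] hx(1) has_vector_derivative_continuous by force
  then have "\<forall>\<^sub>F t in at 0. dist (x t) (x 0) < e" using e by (simp add: isCont_def tendsto_iff)
  then obtain d where d: "0 < d" "\<And>t. t \<noteq> 0 \<Longrightarrow> dist t 0 < d \<Longrightarrow> dist (x t) (x 0) < e"
    by (auto simp: eventually_at)
  have ball: "x t \<in> cball x0 e" if "t \<in> {-min h d<..<min h d}" for t
  proof (cases "t = 0")
    case False
    then have "dist (x t) (x 0) < e" using that by (intro d(2)) auto
    then show ?thesis using hx(2) by (simp add: dist_commute)
  qed (use hx(2) e in auto)
  show thesis
  proof (rule that[of "min h d" x])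
    fix t assume t: "t \<in> {-min h d<..<min h d}"
    then show "(x has_vector_derivative f (x t)) (at t)"
      using hx(3)[of t] closest_point_self[OF ball[OF t]] by auto
  qed (use hx d ball in auto)
qed

text \<open>Continuity is asked of each directional derivative, the form in which
  \<open>C_on\<close> supplies it. Compactness bounds the derivative in each of the finitely many
  basis directions, the sum of these bounds controls the operator norm, and the mean value
  inequality on the convex ball concludes.\<close>

lemma continuous_derivative_imp_lipschitz_on_cball:
  fixes f :: "'a::euclidean_space \<Rightarrow> 'b::real_normed_vector"
  assumes f': "\<And>x. x \<in> cball x0 e \<Longrightarrow> (f has_derivative f' x) (at x)"
    and cont: "\<And>v. continuous_on (cball x0 e) (\<lambda>x. f' x v)"
  obtains L where "L-lipschitz_on (cball x0 e) f"
proof -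
  have "\<exists>M. \<forall>x\<in>cball x0 e. norm (f' x v) \<le> M" for v
    using compact_imp_bounded[OF compact_continuous_image[OF cont compact_cball]]
    by (auto simp: bounded_iff)
  then obtain M where M: "\<And>v x. x \<in> cball x0 e \<Longrightarrow> norm (f' x v) \<le> M v" by metis
  \<comment> \<open>The sign of \<open>e\<close> is not fixed. On an empty ball the bounds
    \<open>M i\<close> are arbitrary, and the absolute values keep \<open>L\<close> nonnegative even
    then.\<close>
  define L where "L = (\<Sum>i\<in>Basis. \<bar>M i\<bar>)"
  have L0: "0 \<le> L" unfolding L_def by (intro sum_nonneg) auto
  have bd: "norm (f' x v) \<le> L * norm v" if x: "x \<in> cball x0 e" for x v
  proof -
    have lin: "linear (f' x)" using f'[OF x] by (rule has_derivative_linear)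
    have "f' x v = f' x (\<Sum>i\<in>Basis. (v \<bullet> i) *\<^sub>R i)" by (simp add: euclidean_representation)
    also have "\<dots> = (\<Sum>i\<in>Basis. (v \<bullet> i) *\<^sub>R f' x i)"
      by (simp add: linear_sum[OF lin] linear_scale[OF lin])
    finally have "norm (f' x v) \<le> (\<Sum>i\<in>Basis. norm ((v \<bullet> i) *\<^sub>R f' x i))"
      by (simp only: norm_sum)
    also have "\<dots> \<le> (\<Sum>i\<in>Basis. norm v * \<bar>M i\<bar>)"
    proof (rule sum_mono)
      fix i :: 'a assume "i \<in> Basis"
      then show "norm ((v \<bullet> i) *\<^sub>R f' x i) \<le> norm v * \<bar>M i\<bar>"
        using M[OF x, of i] by (auto intro!: mult_mono Basis_le_norm)
    qed
    also have "\<dots> = L * norm v" by (simp add: L_def sum_distrib_left mult.commute)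
    finally show ?thesis .
  qed
  show thesis
  proof (rule that, rule lipschitz_onI)
    fix x y assume xy: "x \<in> cball x0 e" "y \<in> cball x0 e"
    have "norm (f x - f y) \<le> L * norm (x - y)"
    proof (rule differentiable_bound[OF convex_cball[of x0 e]])
      fix z assume z: "z \<in> cball x0 e"
      show "(f has_derivative f' z) (at z within cball x0 e)"
        using f'[OF z] by (rule has_derivative_at_withinI)
      show "onorm (f' z) \<le> L" by (rule onorm_le) (rule bd[OF z])
    qed (use xy in auto)
    then show "dist (f x) (f y) \<le> L * dist x y" by (simp add: dist_norm)
  qed (rule L0)
qed

text \<open>Let \<open>z\<close> be a local solution through \<open>z0\<close>. The velocity of the
  curve \<open>\<Phi> (z t)\<close> at time 0 is computed twice, by the chain rule and by
  invariance. Continuity of \<open>V' z v\<close> in \<open>z\<close> serves to make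
  \<open>V\<close> Lipschitz near \<open>z0\<close>, so that such a solution exists.\<close>

lemma invariance_imp_homological_equation:
  fixes V :: "'a::euclidean_space \<Rightarrow> 'a" and \<Phi> :: "'a \<Rightarrow> 'b::real_normed_vector"
  assumes S: "open S" "z0 \<in> S"
    and V': "\<And>z. z \<in> S \<Longrightarrow> (V has_derivative V' z) (at z)"
    and cont: "\<And>v. continuous_on S (\<lambda>z. V' z v)"
    and inv: "\<And>p q z. (\<And>t. t \<in> {p<..<q} \<Longrightarrow> z t \<in> S \<and> (z has_vector_derivative V (z t)) (at t))
        \<Longrightarrow> (\<And>t. t \<in> {p<..<q} \<Longrightarrow> ((\<lambda>t. \<Phi> (z t)) has_vector_derivative F (\<Phi> (z t))) (at t))"
    and \<Phi>: "(\<Phi> has_derivative \<Phi>') (at z0)"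
  shows "\<Phi>' (V z0) = F (\<Phi> z0)"
proof -
  obtain e where e: "0 < e" "cball z0 e \<subseteq> S" using S open_contains_cball by blast
  obtain L where "L-lipschitz_on (cball z0 e) V"
  proof (rule continuous_derivative_imp_lipschitz_on_cball)
    show "\<And>z. z \<in> cball z0 e \<Longrightarrow> (V has_derivative V' z) (at z)" using V' e by blast
    show "\<And>v. continuous_on (cball z0 e) (\<lambda>z. V' z v)" using cont e continuous_on_subset by blast
  qed
  then obtain h z where h: "0 < h" "z 0 = z0" "\<And>t. t \<in> {-h<..<h} \<Longrightarrow> z t \<in> cball z0 e"
    "\<And>t. t \<in> {-h<..<h} \<Longrightarrow> (z has_vector_derivative V (z t)) (at t)"
    using Picard_Lindelof_local e(1) by metis
  have "((\<lambda>t. \<Phi> (z t)) has_vector_derivative F (\<Phi> (z 0))) (at 0)"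
    by (rule inv[of "-h" h]) (use h e in auto)
  moreover have "((\<lambda>t. \<Phi> (z t)) has_vector_derivative \<Phi>' (V z0)) (at 0)"
  proof -
    have z: "(z has_derivative (\<lambda>t. t *\<^sub>R V z0)) (at 0)"
      using h(4)[of 0] h(1,2) by (simp add: has_vector_derivative_def)
    have "(\<Phi> has_derivative \<Phi>') (at (z 0))" using \<Phi> h(2) by simp
    from has_derivative_compose[OF z this] show ?thesis
      using has_derivative_linear[OF \<Phi>] by (simp add: has_vector_derivative_def linear_scale)
  qed
  ultimately show ?thesis using vector_derivative_unique_at h(2) by metis
qed

section \<open>Second-order expansions\<close>

lemma onorm_scaleR_vector_le:
  assumes "norm v \<le> B"
  shows "onorm (\<lambda>h::real. h *\<^sub>R v) \<le> B"
proof (rule onorm_le)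
  fix h :: real
  show "norm (h *\<^sub>R v) \<le> B * norm h"
    using mult_left_mono[OF assms, of "\<bar>h\<bar>"] by (simp add: mult.commute)
qed

text \<open>This is the core of Schwarz's theorem: the second difference is symmetric in
  \<open>v\<close> and \<open>w\<close>, while its limit is the derivative taken first along
  \<open>v\<close>, then along \<open>w\<close>. The mean value inequality in the direction
  \<open>v\<close> reduces the claim to the linear approximation at \<open>x\<close> of the
  derivative along \<open>v\<close>.\<close>

lemma symmetric_difference_quotient:
  fixes f :: "'a::real_normed_vector \<Rightarrow> 'b::real_normed_vector"
  assumes S: "open S" "x \<in> S"
    and f: "\<And>y. y \<in> S \<Longrightarrow> f differentiable (at y)"
    and g: "((\<lambda>y. frechet_derivative f (at y) v) has_derivative L) (at x)"
  shows "((\<lambda>s. (f (x + s *\<^sub>R v + s *\<^sub>R w) - f (x + s *\<^sub>R v) - f (x + s *\<^sub>R w) + f x) /\<^sub>R s\<^sup>2) \<longlongrightarrow> L w) (at_right 0)"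
proof (rule tendstoI)
  fix e :: real assume e: "0 < e"
  \<comment> \<open>\<open>s * K\<close> bounds all displacements from \<open>x\<close> that occur,
    and the 1 keeps \<open>K\<close> positive when \<open>v\<close> and \<open>w\<close> vanish. The
    final error is \<open>2 * \<epsilon> * K\<close>, which the next choice turns into
    \<open>e / 2\<close>.\<close>
  define K where "K = norm v + norm w + 1"
  have K: "0 < K" by (simp add: K_def add_nonneg_pos)
  define \<epsilon> where "\<epsilon> = e / (4 * K)"
  have \<epsilon>: "0 < \<epsilon>" using e K by (simp add: \<epsilon>_def)
  let ?D = "\<lambda>y. frechet_derivative f (at y) v"
  obtain d where d: "0 < d" "\<And>y. norm (y - x) < d \<Longrightarrow>
      norm (?D y - ?D x - L (y - x)) \<le> \<epsilon> * norm (y - x)"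
    using g \<epsilon> unfolding has_derivative_at_alt by blast
  obtain d' where d': "0 < d'" "ball x d' \<subseteq> S" using S open_contains_ball by blast
  have linL: "linear L" using g has_derivative_linear by blast
  have "\<forall>\<^sub>F s in at_right 0. s < min d d' / K"
    using d d' K by (intro order_tendstoD(2)[OF tendsto_ident_at]) auto
  moreover have "\<forall>\<^sub>F s in at_right 0. (0::real) < s" by (simp add: eventually_at_right_less)
  ultimately show "\<forall>\<^sub>F s in at_right 0.
      dist ((f (x + s *\<^sub>R v + s *\<^sub>R w) - f (x + s *\<^sub>R v) - f (x + s *\<^sub>R w) + f x) /\<^sub>R s\<^sup>2) (L w) < e"
  proof eventually_elim
    fix s :: real assume s: "s < min d d' / K" "0 < s"
    have sK: "s * K < d" "s * K < d'" using s K by (auto simp: field_simps)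
    \<comment> \<open>The difference in the direction \<open>w\<close>, followed along
      \<open>v\<close>, minus its expected linear growth. Thus \<open>k s - k 0\<close> is the
      second difference minus \<open>s\<^sup>2 *\<^sub>R L w\<close>.\<close>
    define k where "k = (\<lambda>r. f (x + r *\<^sub>R v + s *\<^sub>R w) - f (x + r *\<^sub>R v) - r *\<^sub>R (s *\<^sub>R L w))"
    have near: "norm (r *\<^sub>R v + s *\<^sub>R w) \<le> s * K" "norm (r *\<^sub>R v) \<le> s * K" if "r \<in> {0..s}" for r
    proof -
      have a: "r * norm v \<le> s * norm v" using that by (intro mult_right_mono) auto
      have "norm (r *\<^sub>R v + s *\<^sub>R w) \<le> r * norm v + s * norm w"
        using norm_triangle_ineq[of "r *\<^sub>R v" "s *\<^sub>R w"] that s by auto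
      also have "\<dots> \<le> s * K" using a s by (simp add: K_def algebra_simps)
      finally show "norm (r *\<^sub>R v + s *\<^sub>R w) \<le> s * K" .
      have "0 \<le> s * norm w" using s by simp
      then have "r * norm v \<le> s * K" using a s unfolding K_def distrib_left by linarith
      then show "norm (r *\<^sub>R v) \<le> s * K" using that by simp
    qed
    have kd: "(k has_derivative (\<lambda>h. h *\<^sub>R (?D (x + r *\<^sub>R v + s *\<^sub>R w) - ?D (x + r *\<^sub>R v) - s *\<^sub>R L w)))
        (at r within {0..s})" if r: "r \<in> {0..s}" for r
    proof -
      have "x + r *\<^sub>R v + s *\<^sub>R w \<in> S" "x + r *\<^sub>R v \<in> S"
        using near[OF r] sK d'(2) by (auto simp: subset_iff dist_norm norm_minus_commute algebra_simps)
      note h = f[OF this(1), unfolded frechet_derivative_works] f[OF this(2), unfolded frechet_derivative_works]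
      have l: "(\<lambda>h. frechet_derivative f (at y) (h *\<^sub>R v)) = (\<lambda>h. h *\<^sub>R ?D y)" if "f differentiable at y" for y
        using linear_frechet_derivative[OF that] by (simp add: linear_scale)
      have "((\<lambda>r. f (x + r *\<^sub>R v + s *\<^sub>R w)) has_derivative (\<lambda>h. frechet_derivative f (at (x + r *\<^sub>R v + s *\<^sub>R w)) (h *\<^sub>R v))) (at r within {0..s})"
        by (rule has_derivative_compose[of "\<lambda>r. x + r *\<^sub>R v + s *\<^sub>R w" "\<lambda>h. h *\<^sub>R v", OF _ h(1)]) (auto intro!: derivative_eq_intros)
      moreover have "((\<lambda>r. f (x + r *\<^sub>R v)) has_derivative (\<lambda>h. frechet_derivative f (at (x + r *\<^sub>R v)) (h *\<^sub>R v))) (at r within {0..s})"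
        by (rule has_derivative_compose[of "\<lambda>r. x + r *\<^sub>R v" "\<lambda>h. h *\<^sub>R v", OF _ h(2)]) (auto intro!: derivative_eq_intros)
      ultimately show ?thesis using f \<open>x + r *\<^sub>R v + s *\<^sub>R w \<in> S\<close> \<open>x + r *\<^sub>R v \<in> S\<close>
        unfolding k_def by (auto intro!: derivative_eq_intros simp: l algebra_simps)
    qed
    have "norm (k s - k 0) \<le> (2 * \<epsilon> * s * K) * norm (s - 0)"
    proof (rule differentiable_bound[OF _ kd])
      fix r assume r: "r \<in> {0..s}"
      let ?y = "x + r *\<^sub>R v + s *\<^sub>R w" and ?z = "x + r *\<^sub>R v"
      have "norm (?D ?y - ?D x - L (?y - x)) \<le> \<epsilon> * norm (?y - x)"
        using near[OF r] sK by (intro d) (auto simp: algebra_simps)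
      also have "\<dots> \<le> \<epsilon> * (s * K)" using near[OF r] \<epsilon> by (intro mult_left_mono) (auto simp: algebra_simps)
      finally have 1: "norm (?D ?y - ?D x - L (?y - x)) \<le> \<epsilon> * (s * K)" .
      have "norm (?D ?z - ?D x - L (?z - x)) \<le> \<epsilon> * norm (?z - x)"
        using near[OF r] sK by (intro d) (auto simp: algebra_simps)
      also have "\<dots> \<le> \<epsilon> * (s * K)" using near[OF r] \<epsilon> by (intro mult_left_mono) (auto simp: algebra_simps)
      finally have 2: "norm (?D ?z - ?D x - L (?z - x)) \<le> \<epsilon> * (s * K)" .
      \<comment> \<open>Both derivatives are compared with the linear approximation at
        \<open>x\<close>. Since \<open>?y - ?z = s *\<^sub>R w\<close>, the two linear parts differ
        by exactly \<open>s *\<^sub>R L w\<close>.\<close>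
      have "?D ?y - ?D ?z - s *\<^sub>R L w = (?D ?y - ?D x - L (?y - x)) - (?D ?z - ?D x - L (?z - x))"
        using linL by (simp add: linear_add linear_scale linear_diff algebra_simps)
      then have "norm (?D ?y - ?D ?z - s *\<^sub>R L w) \<le> 2 * \<epsilon> * s * K"
        using norm_triangle_ineq4[of "?D ?y - ?D x - L (?y - x)" "?D ?z - ?D x - L (?z - x)"] 1 2
        by (simp only:)
      then show "onorm (\<lambda>h. h *\<^sub>R (?D ?y - ?D ?z - s *\<^sub>R L w)) \<le> 2 * \<epsilon> * s * K"
        by (rule onorm_scaleR_vector_le)
    qed (use s in auto)
    then have b: "norm (k s - k 0) \<le> s\<^sup>2 * (2 * \<epsilon> * K)" using s by (simp add: power2_eq_square mult_ac)
    have "(f (x + s *\<^sub>R v + s *\<^sub>R w) - f (x + s *\<^sub>R v) - f (x + s *\<^sub>R w) + f x) /\<^sub>R s\<^sup>2 - L w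
       = (k s - k 0) /\<^sub>R s\<^sup>2"
      using s by (simp add: k_def power2_eq_square scaleR_diff_right scaleR_add_right algebra_simps)
    then have "dist ((f (x + s *\<^sub>R v + s *\<^sub>R w) - f (x + s *\<^sub>R v) - f (x + s *\<^sub>R w) + f x) /\<^sub>R s\<^sup>2) (L w)
      = norm (k s - k 0) / s\<^sup>2" by (simp add: dist_norm divide_inverse mult.commute)
    also have "\<dots> \<le> 2 * \<epsilon> * K" using b s by (simp add: field_simps)
    also have "\<dots> < e" using e K by (simp add: \<epsilon>_def)
    finally show "dist ((f (x + s *\<^sub>R v + s *\<^sub>R w) - f (x + s *\<^sub>R v) - f (x + s *\<^sub>R w) + f x) /\<^sub>R s\<^sup>2) (L w) < e" .
  qed
qed

text \<open>The second difference quotient does not change when \<open>v\<close> and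
  \<open>w\<close> are exchanged, so its two limits agree.\<close>

lemma C_on_2_mixed_derivatives_commute:
  assumes "C_on (Suc (Suc k)) f S" "open S" "x \<in> S"
  shows "frechet_derivative (\<lambda>y. frechet_derivative f (at y) v) (at x) w =
    frechet_derivative (\<lambda>y. frechet_derivative f (at y) w) (at x) v"
proof -
  have d: "((\<lambda>y. frechet_derivative f (at y) u) has_derivative
      frechet_derivative (\<lambda>y. frechet_derivative f (at y) u) (at x)) (at x)" for u
    by (rule frechet_derivative_works[THEN iffD1]) (use assms in auto)
  have f: "\<And>y. y \<in> S \<Longrightarrow> f differentiable (at y)" using assms by auto
  show ?thesis
    by (rule tendsto_unique[OF _ symmetric_difference_quotient[OF assms(2,3) f d, of v w]])
      (use symmetric_difference_quotient[OF assms(2,3) f d, of w v] in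
        \<open>simp_all add: algebra_simps\<close>)
qed

text \<open>Taylor's formula with Peano remainder: \<open>g'\<close> is differentiated at 0 alone.
  The remainder \<open>k\<close> has derivative of order o(r) at r, and the mean value inequality
  makes its increment o(\<open>s\<^sup>2\<close>).\<close>

lemma second_order_Taylor_tendsto:
  fixes g :: "real \<Rightarrow> 'b::real_normed_vector"
  assumes e: "0 < e"
    and g: "\<And>s. \<bar>s\<bar> < e \<Longrightarrow> (g has_vector_derivative g' s) (at s)"
    and g': "(g' has_vector_derivative c) (at 0)"
  shows "((\<lambda>s. (g s - g 0 - s *\<^sub>R g' 0) /\<^sub>R s\<^sup>2) \<longlongrightarrow> c /\<^sub>R 2) (at 0)"
proof (rule tendstoI)
  fix \<epsilon> :: real assume \<epsilon>: "0 < \<epsilon>"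
  obtain d where d: "0 < d" "\<And>y. norm (y - 0) < d \<Longrightarrow>
      norm (g' y - g' 0 - (y - 0) *\<^sub>R c) \<le> \<epsilon> / 2 * norm (y - 0)"
    using g' \<epsilon> unfolding has_vector_derivative_def has_derivative_at_alt
    by (meson half_gt_zero)
  have "\<forall>\<^sub>F s in at 0. \<bar>s\<bar> < min d e"
    using d e by (auto simp: eventually_at intro!: exI[of _ "min d e"])
  moreover have "\<forall>\<^sub>F s in at (0::real). s \<noteq> 0" by (auto simp: eventually_at intro!: exI[of _ 1])
  ultimately show "\<forall>\<^sub>F s in at 0. dist ((g s - g 0 - s *\<^sub>R g' 0) /\<^sub>R s\<^sup>2) (c /\<^sub>R 2) < \<epsilon>"
  proof eventually_elim
    fix s :: real assume s: "\<bar>s\<bar> < min d e" "s \<noteq> 0"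
    define k where "k = (\<lambda>r. g r - r *\<^sub>R g' 0 - (r\<^sup>2 / 2) *\<^sub>R c)"
    have r: "\<bar>r\<bar> \<le> \<bar>s\<bar>" if "r \<in> closed_segment 0 s" for r
      using that by (auto simp: closed_segment_eq_real_ivl split: if_splits)
    have kd: "(k has_derivative (\<lambda>h. h *\<^sub>R (g' r - g' 0 - r *\<^sub>R c))) (at r within closed_segment 0 s)"
      if "r \<in> closed_segment 0 s" for r
    proof -
      have "(g has_derivative (\<lambda>h. h *\<^sub>R g' r)) (at r)"
        using g[of r] r[OF that] s by (auto simp: has_vector_derivative_def)
      then have "(g has_derivative (\<lambda>h. h *\<^sub>R g' r)) (at r within closed_segment 0 s)"
        by (rule has_derivative_at_withinI)
      then show ?thesis unfolding k_def
        by (auto intro!: derivative_eq_intros simp: algebra_simps)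
    qed
    have "norm (k s - k 0) \<le> (\<epsilon> / 2 * \<bar>s\<bar>) * norm (s - 0)"
    proof (rule differentiable_bound[OF convex_closed_segment kd])
      fix y assume y: "y \<in> closed_segment 0 s"
      have "norm (g' y - g' 0 - y *\<^sub>R c) \<le> \<epsilon> / 2 * \<bar>y\<bar>"
        using d(2)[of y] r[OF y] s by auto
      also have "\<dots> \<le> \<epsilon> / 2 * \<bar>s\<bar>" using r[OF y] \<epsilon> by simp
      finally show "onorm (\<lambda>h. h *\<^sub>R (g' y - g' 0 - y *\<^sub>R c)) \<le> \<epsilon> / 2 * \<bar>s\<bar>"
        by (rule onorm_scaleR_vector_le)
    qed auto
    then have b: "norm (k s - k 0) \<le> \<epsilon> / 2 * s\<^sup>2" by (simp add: power2_eq_square)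
    have "k s - k 0 = (g s - g 0 - s *\<^sub>R g' 0) - s\<^sup>2 *\<^sub>R (c /\<^sub>R 2)"
      by (simp add: k_def)
    then have "(g s - g 0 - s *\<^sub>R g' 0) /\<^sub>R s\<^sup>2 - c /\<^sub>R 2 = (k s - k 0) /\<^sub>R s\<^sup>2"
      using s by (simp only: scaleR_diff_right scaleR_scaleR) simp
    then have "dist ((g s - g 0 - s *\<^sub>R g' 0) /\<^sub>R s\<^sup>2) (c /\<^sub>R 2) = norm ((k s - k 0) /\<^sub>R s\<^sup>2)"
      by (simp only: dist_norm)
    also have "\<dots> = norm (k s - k 0) / s\<^sup>2"
      by (simp add: divide_inverse_commute)
    also have "\<dots> \<le> \<epsilon> / 2" using b s by (simp add: field_simps)
    finally show "dist ((g s - g 0 - s *\<^sub>R g' 0) /\<^sub>R s\<^sup>2) (c /\<^sub>R 2) < \<epsilon>" using \<epsilon> by simp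
  qed
qed

section \<open>Directional derivatives and expansions along rays\<close>

abbreviation dird :: "('a::real_normed_vector \<Rightarrow> 'b::real_normed_vector) \<Rightarrow> 'a \<Rightarrow> 'a \<Rightarrow> 'b" where
  "dird f v x \<equiv> frechet_derivative f (at x) v"

lemma C_on_differentiable:
  assumes "C_on (Suc k) f S" "x \<in> S"
  shows "f differentiable at x"
  using assms by simp

lemma C_on_dird:
  assumes "C_on (Suc k) f S"
  shows "C_on k (dird f v) S"
  using assms by simp

lemma dird_has_vector_derivative:
  assumes "f differentiable at (c t)" "(c has_vector_derivative c') (at t)"
  shows "((\<lambda>t. f (c t)) has_vector_derivative dird f c' (c t)) (at t)"
proof -
  have f: "(f has_derivative frechet_derivative f (at (c t))) (at (c t))"
    using assms(1) frechet_derivative_works by blast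
  from has_derivative_compose[OF assms(2)[unfolded has_vector_derivative_def] f]
  show ?thesis
    using linear_frechet_derivative[OF assms(1)] by (simp add: has_vector_derivative_def linear_scale)
qed

lemma has_vector_derivative_imp_quotient_tendsto:
  assumes "(g has_vector_derivative c) (at 0)" "g 0 = 0"
  shows "((\<lambda>s. g s /\<^sub>R s) \<longlongrightarrow> c) (at 0)"
proof -
  have lim: "((\<lambda>s. norm ((g s - s *\<^sub>R c) /\<^sub>R \<bar>s\<bar>)) \<longlongrightarrow> 0) (at 0)"
    using assms by (intro tendsto_norm_zero) (simp add: has_vector_derivative_def has_derivative_def)
  have eq: "norm ((g s - s *\<^sub>R c) /\<^sub>R \<bar>s\<bar>) = norm (g s /\<^sub>R s - c)" if "s \<noteq> 0" for s
  proof -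
    have "g s /\<^sub>R s - c = (g s - s *\<^sub>R c) /\<^sub>R s" using that by (simp add: scaleR_diff_right)
    then show ?thesis by simp
  qed
  have "((\<lambda>s. norm (g s /\<^sub>R s - c)) \<longlongrightarrow> 0) (at 0)"
    by (rule LIM_equal[THEN iffD1, OF _ lim]) (use eq in auto)
  then show ?thesis by (rule LIM_zero_cancel[OF tendsto_norm_zero_cancel])
qed

text \<open>Here \<open>f\<close> plays the role of H as a function of all variables, flat along the
  cycle \<xi> = 0. On the ray \<xi> = s w both \<open>f\<close> and its \<tau>-derivative are of
  order \<open>s\<^sup>2\<close>, and \<open>K'\<close> is at once the derivative of
  \<open>K\<close> and the second ray derivative of the \<tau>-derivative. This identification lets
  the homological equation become a differential equation for the quadratic coefficients.\<close>

lemma flat_quadratic_expansion: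
  fixes f :: "real \<times> 'a::euclidean_space \<Rightarrow> 'b::real_normed_vector" and w :: 'a
  assumes f: "C_on 3 f (UNIV \<times> ball 0 \<delta>)" and \<delta>: "0 < \<delta>"
    and f0: "\<And>\<tau>. f (\<tau>, 0) = 0" and df0: "\<And>\<tau> v. dird f v (\<tau>, 0) = 0"
  defines "K \<equiv> \<lambda>\<tau>. dird (dird f (0, w)) (0, w) (\<tau>, 0)"
    and "K' \<equiv> \<lambda>\<tau>. dird (dird (dird f (0, w)) (0, w)) (1, 0) (\<tau>, 0)"
  shows "(K has_vector_derivative K' \<tau>) (at \<tau>)"
    and "((\<lambda>s. dird f (0, w) (\<tau>, s *\<^sub>R w)) has_vector_derivative K \<tau>) (at 0)"
    and "((\<lambda>s. f (\<tau>, s *\<^sub>R w) /\<^sub>R s\<^sup>2) \<longlongrightarrow> K \<tau> /\<^sub>R 2) (at 0)"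
    and "((\<lambda>s. dird f (1, 0) (\<tau>, s *\<^sub>R w) /\<^sub>R s\<^sup>2) \<longlongrightarrow> K' \<tau> /\<^sub>R 2) (at 0)"
    and "((\<lambda>s. dird f (0, u) (\<tau>, s *\<^sub>R w) /\<^sub>R s) \<longlongrightarrow> dird (dird f (0, u)) (0, w) (\<tau>, 0)) (at 0)"
proof -
  let ?S = "UNIV \<times> ball (0::'a) \<delta> :: (real \<times> 'a) set"
  have S: "open ?S" "\<And>\<tau>. (\<tau>, 0) \<in> ?S" using \<delta> by (auto intro: open_Times)
  have f3: "C_on (Suc (Suc (Suc 0))) f ?S" using f by (simp add: numeral_3_eq_3)
  then have f2: "C_on (Suc (Suc 0)) (dird f v) ?S" for v by (rule C_on_dird)
  then have f1: "C_on (Suc 0) (dird (dird f v) v') ?S" for v v' by (rule C_on_dird)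
  have d: "x \<in> ?S \<Longrightarrow> f differentiable at x" "x \<in> ?S \<Longrightarrow> dird f v differentiable at x"
    "x \<in> ?S \<Longrightarrow> dird (dird f v) v' differentiable at x" for x v v'
    using C_on_differentiable[OF f3] C_on_differentiable[OF f2] C_on_differentiable[OF f1] by blast+
  define e where "e = \<delta> / (norm w + 1)"
  have w1: "0 < norm w + 1" by (simp add: add_nonneg_pos)
  then have e: "0 < e" using \<delta> by (simp add: e_def)
  have line: "(\<tau>, s *\<^sub>R w) \<in> ?S" if "\<bar>s\<bar> < e" for s
  proof -
    have "\<bar>s\<bar> * (norm w + 1) < \<delta>" using that w1 by (simp add: e_def pos_less_divide_eq)
    moreover have "\<bar>s\<bar> * norm w \<le> \<bar>s\<bar> * (norm w + 1)" by (intro mult_left_mono) auto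
    ultimately show ?thesis by simp
  qed
  have lw: "((\<lambda>s. g (\<tau>, s *\<^sub>R w)) has_vector_derivative dird g (0, w) (\<tau>, s *\<^sub>R w)) (at s)"
    if "g differentiable at (\<tau>, s *\<^sub>R w)" for s and g :: "real \<times> 'a \<Rightarrow> 'b"
    by (rule dird_has_vector_derivative[where c = "\<lambda>s. (\<tau>, s *\<^sub>R w)", OF that])
      (auto intro!: derivative_eq_intros has_vector_derivative_Pair)
  have lt: "((\<lambda>t. g (t, 0)) has_vector_derivative dird g (1, 0) (t, 0)) (at t)"
    if "g differentiable at (t, 0)" for t and g :: "real \<times> 'a \<Rightarrow> 'b"
    by (rule dird_has_vector_derivative[where c = "\<lambda>t. (t, 0)", OF that])
      (auto intro!: derivative_eq_intros has_vector_derivative_Pair)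
  show "(K has_vector_derivative K' \<tau>) (at \<tau>)"
    unfolding K_def K'_def by (rule lt) (rule d(3)[OF S(2)])
  show K: "((\<lambda>s. dird f (0, w) (\<tau>, s *\<^sub>R w)) has_vector_derivative K \<tau>) (at 0)"
    using lw[of "dird f (0, w)" 0] d(2)[OF S(2)] by (simp add: K_def)
  have "((\<lambda>s. (f (\<tau>, s *\<^sub>R w) - f (\<tau>, 0 *\<^sub>R w) - s *\<^sub>R dird f (0, w) (\<tau>, 0 *\<^sub>R w)) /\<^sub>R s\<^sup>2)
      \<longlongrightarrow> K \<tau> /\<^sub>R 2) (at 0)"
    by (rule second_order_Taylor_tendsto[OF e _ K]) (rule lw, rule d(1), rule line)
  then show "((\<lambda>s. f (\<tau>, s *\<^sub>R w) /\<^sub>R s\<^sup>2) \<longlongrightarrow> K \<tau> /\<^sub>R 2) (at 0)"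
    by (simp add: f0 df0)
  show "((\<lambda>s. dird f (0, u) (\<tau>, s *\<^sub>R w) /\<^sub>R s) \<longlongrightarrow> dird (dird f (0, u)) (0, w) (\<tau>, 0)) (at 0)"
  proof -
    have "((\<lambda>s. dird f (0, u) (\<tau>, s *\<^sub>R w)) has_vector_derivative dird (dird f (0, u)) (0, w) (\<tau>, 0)) (at 0)"
      using lw[of "dird f (0, u)" 0] d(2)[OF S(2)] by simp
    then show ?thesis by (rule has_vector_derivative_imp_quotient_tendsto) (simp add: df0)
  qed
  have comm: "dird (dird g v) v' x = dird (dird g v') v x" if "C_on (Suc (Suc k)) g ?S" "x \<in> ?S"
    for k g v v' x
    using C_on_2_mixed_derivatives_commute[OF that(1) S(1) that(2)] .
  \<comment> \<open>The derivative of \<open>f\<close> along \<open>w\<close> is zero on the whole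
    cycle, hence so is its \<tau>-derivative. Exchanging the order removes the term of order
    \<open>s\<close> from the expansion of the \<tau>-derivative.\<close>
  have "dird (dird f (1, 0)) (0, w) (\<tau>, 0) = 0"
  proof -
    have "((\<lambda>t. dird f (0, w) (t, 0)) has_vector_derivative dird (dird f (0, w)) (1, 0) (\<tau>, 0)) (at \<tau>)"
      by (rule lt) (rule d(2)[OF S(2)])
    then have "dird (dird f (0, w)) (1, 0) (\<tau>, 0) = 0"
      unfolding df0 using vector_derivative_unique_at has_vector_derivative_const by blast
    then show ?thesis using comm[OF f3 S(2)] by metis
  qed
  moreover have "((\<lambda>s. (dird f (1, 0) (\<tau>, s *\<^sub>R w) - dird f (1, 0) (\<tau>, 0 *\<^sub>R w) -
      s *\<^sub>R dird (dird f (1, 0)) (0, w) (\<tau>, 0 *\<^sub>R w)) /\<^sub>R s\<^sup>2) \<longlongrightarrow> K' \<tau> /\<^sub>R 2) (at 0)"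
  proof (rule second_order_Taylor_tendsto[OF e, where g = "\<lambda>s. dird f (1, 0) (\<tau>, s *\<^sub>R w)" and
        g' = "\<lambda>s. dird (dird f (1, 0)) (0, w) (\<tau>, s *\<^sub>R w)"])
    show "((\<lambda>s. dird f (1, 0) (\<tau>, s *\<^sub>R w)) has_vector_derivative
      dird (dird f (1, 0)) (0, w) (\<tau>, s *\<^sub>R w)) (at s)" if "\<bar>s\<bar> < e" for s
      by (rule lw, rule d(2), rule line) (rule that)
    \<comment> \<open>The \<tau>-derivative is moved outward past the two derivatives along
      \<open>w\<close>, one at a time. The inner exchange must hold on an open set, since its result
      is differentiated again.\<close>
    have "dird (dird (dird f (1, 0)) (0, w)) (0, w) (\<tau>, 0) = dird (dird (dird f (0, w)) (1, 0)) (0, w) (\<tau>, 0)"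
    proof -
      have "frechet_derivative (dird (dird f (1, 0)) (0, w)) (at (\<tau>, 0)) =
          frechet_derivative (dird (dird f (0, w)) (1, 0)) (at (\<tau>, 0))"
        by (rule frechet_derivative_transform_within_open[OF d(3)[OF S(2)] S(1) S(2)]) (rule comm[OF f3])
      then show ?thesis by simp
    qed
    also have "\<dots> = K' \<tau>" unfolding K'_def by (rule comm[OF f2 S(2)])
    finally show "((\<lambda>s. dird (dird f (1, 0)) (0, w) (\<tau>, s *\<^sub>R w)) has_vector_derivative K' \<tau>) (at 0)"
      using lw[of "dird (dird f (1, 0)) (0, w)" 0] d(3)[OF S(2)] by simp
  qed
  ultimately show "((\<lambda>s. dird f (1, 0) (\<tau>, s *\<^sub>R w) /\<^sub>R s\<^sup>2) \<longlongrightarrow> K' \<tau> /\<^sub>R 2) (at 0)"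
    by (simp add: df0)
qed

text \<open>The second-order chain rule for \<open>F\<close> along the curve
  \<open>x + s *\<^sub>R p + g s\<close>, which has velocity \<open>p\<close> and acceleration
  \<open>c\<close> at \<open>s = 0\<close>.\<close>

lemma composition_second_order_tendsto:
  fixes F :: "'a::euclidean_space \<Rightarrow> 'b::real_normed_vector"
  assumes F: "C_on (Suc (Suc k)) F UNIV" and e: "0 < e"
    and g: "\<And>s. \<bar>s\<bar> < e \<Longrightarrow> (g has_vector_derivative g' s) (at s)" "g 0 = 0" "g' 0 = 0"
    and g': "(g' has_vector_derivative c) (at 0)"
  shows "((\<lambda>s. (F (x + s *\<^sub>R p + g s) - F x - s *\<^sub>R dird F p x) /\<^sub>R s\<^sup>2) \<longlongrightarrow>
    (dird (dird F p) p x + dird F c x) /\<^sub>R 2) (at 0)"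
proof -
  have d: "F differentiable at y" "dird F v differentiable at y" for v y using F by auto
  have lin: "linear (frechet_derivative F (at y))" for y by (rule linear_frechet_derivative[OF d(1)])
  let ?c = "\<lambda>s. x + s *\<^sub>R p + g s"
  have c: "(?c has_vector_derivative p + g' s) (at s)" if "\<bar>s\<bar> < e" for s
    by (auto intro!: derivative_eq_intros g that)
  have c0: "(?c has_vector_derivative p) (at 0)" using c[of 0] e g by simp
  have "((\<lambda>s. (F (?c s) - F (?c 0) - s *\<^sub>R dird F (p + g' 0) (?c 0)) /\<^sub>R s\<^sup>2) \<longlongrightarrow>
    (dird (dird F p) p x + dird F c x) /\<^sub>R 2) (at 0)"
  proof (rule second_order_Taylor_tendsto[OF e, where g = "\<lambda>s. F (?c s)" and
        g' = "\<lambda>s. dird F (p + g' s) (?c s)"])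
    show "((\<lambda>s. F (?c s)) has_vector_derivative dird F (p + g' s) (?c s)) (at s)" if "\<bar>s\<bar> < e" for s
      by (rule dird_has_vector_derivative[where c = ?c, OF d(1) c[OF that]])
    have 1: "((\<lambda>s. dird F v (?c s)) has_vector_derivative dird (dird F v) p x) (at 0)" for v
      using dird_has_vector_derivative[where c = ?c, OF d(2) c0, of v] g by simp
    \<comment> \<open>In \<open>dird F (g' s) (?c s)\<close> the direction and the base point both
      move with \<open>s\<close>. Expanding the direction in the basis gives products with scalar
      factors, and since \<open>g' 0 = 0\<close> the derivative that falls on the base point
      contributes nothing.\<close>
    have 2: "((\<lambda>s. (g' s \<bullet> i) *\<^sub>R dird F i (?c s)) has_vector_derivative (c \<bullet> i) *\<^sub>R dird F i x) (at 0)" for i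
    proof -
      have "((\<lambda>s. g' s \<bullet> i) has_vector_derivative c \<bullet> i) (at 0)"
        by (rule bounded_linear.has_vector_derivative[OF bounded_linear_inner_left g'])
      then have "((\<lambda>s. g' s \<bullet> i) has_real_derivative c \<bullet> i) (at 0)"
        by (simp add: has_real_derivative_iff_has_vector_derivative)
      from has_vector_derivative_scaleR[OF this 1[of i]] show ?thesis using g by simp
    qed
    have rep: "dird F v y = (\<Sum>i\<in>Basis. (v \<bullet> i) *\<^sub>R dird F i y)" for v y
    proof -
      have "dird F v y = dird F (\<Sum>i\<in>Basis. (v \<bullet> i) *\<^sub>R i) y" by (simp add: euclidean_representation)
      then show ?thesis by (simp add: linear_sum[OF lin] linear_scale[OF lin])
    qed
    have "((\<lambda>s. dird F p (?c s) + (\<Sum>i\<in>Basis. (g' s \<bullet> i) *\<^sub>R dird F i (?c s))) has_vector_derivative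
        dird (dird F p) p x + (\<Sum>i\<in>Basis. (c \<bullet> i) *\<^sub>R dird F i x)) (at 0)"
      by (intro has_vector_derivative_add has_vector_derivative_sum 1 2)
    then show "((\<lambda>s. dird F (p + g' s) (?c s)) has_vector_derivative
        dird (dird F p) p x + dird F c x) (at 0)"
      by (simp add: linear_add[OF lin] flip: rep)
  qed
  then show ?thesis using g by simp
qed

section \<open>Quadratic terms of the homological equation\<close>

text \<open>At a fixed \<tau>, \<open>hom\<close> is the homological equation and \<open>lin\<close>
  is its balance at order \<open>s\<close> on the ray; the conclusion is the balance at order
  \<open>s\<^sup>2\<close>. Only the derivative of \<open>f\<close> in the direction \<xi>1 survives
  there among the two \<xi>-directions: it is multiplied by \<open>X1\<close>, of order
  \<open>s\<close>, whereas \<open>X2\<close> is of order \<open>s\<^sup>2\<close> and the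
  derivatives are themselves of order \<open>s\<close>.\<close>

lemma R1_second_order_balance:
  fixes F :: "'n::euclidean_space \<Rightarrow> 'n" and f :: "real \<times> real \<times> real \<Rightarrow> 'n"
    and w1 w2 \<alpha> a b :: real and r0 r1 r2 :: "real \<times> real \<Rightarrow> real"
  assumes F: "C_on (Suc (Suc k)) F UNIV"
    and f: "C_on 3 f (UNIV \<times> ball 0 \<delta>)" and \<delta>: "0 < \<delta>"
    and f0: "\<And>\<tau>. f (\<tau>, 0) = 0" and df0: "\<And>\<tau> v. dird f v (\<tau>, 0) = 0"
    and r: "\<And>r. r \<in> {r0, r1, r2} \<Longrightarrow> ((\<lambda>s. r (s *\<^sub>R (w1, w2)) / s\<^sup>2) \<longlongrightarrow> 0) (at 0)"
    and hom: "\<And>\<theta> X1 X2 x y. (x, y) \<in> ball 0 \<delta> \<Longrightarrow>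
      \<theta> = 1 - x + \<alpha> * x\<^sup>2 + r0 (x, y) \<Longrightarrow> X1 = y + x * y + r1 (x, y) \<Longrightarrow>
      X2 = a * x\<^sup>2 + b * (x * y) + r2 (x, y) \<Longrightarrow>
      \<theta> *\<^sub>R (F u + x *\<^sub>R V1' + y *\<^sub>R V2') + X1 *\<^sub>R V1 + X2 *\<^sub>R V2 + \<theta> *\<^sub>R dird f (1, 0) (\<tau>, (x, y))
        + X1 *\<^sub>R dird f (0, (1, 0)) (\<tau>, (x, y)) + X2 *\<^sub>R dird f (0, (0, 1)) (\<tau>, (x, y))
      = F (u + x *\<^sub>R V1 + y *\<^sub>R V2 + f (\<tau>, (x, y)))"
    and p: "p = w1 *\<^sub>R V1 + w2 *\<^sub>R V2" and p': "p' = w1 *\<^sub>R V1' + w2 *\<^sub>R V2'"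
    and lin: "dird F p u = p' - w1 *\<^sub>R F u + w2 *\<^sub>R V1"
    and w: "w = (w1, w2)"
  shows "(dird (dird F p) p u + dird F (dird (dird f (0, w)) (0, w) (\<tau>, 0)) u) /\<^sub>R 2 =
    (\<alpha> * w1\<^sup>2) *\<^sub>R F u - w1 *\<^sub>R p' + dird (dird (dird f (0, w)) (0, w)) (1, 0) (\<tau>, 0) /\<^sub>R 2
    + (w1 * w2) *\<^sub>R V1 + w2 *\<^sub>R dird (dird f (0, (1, 0))) (0, w) (\<tau>, 0)
    + (a * w1\<^sup>2 + b * (w1 * w2)) *\<^sub>R V2"
proof -
  note ex = flat_quadratic_expansion[OF f \<delta> f0 df0]
  define g where "g = (\<lambda>s. f (\<tau>, s *\<^sub>R w))"
  define e where "e = \<delta> / (norm w + 1)"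
  have w1: "0 < norm w + 1" by (simp add: add_nonneg_pos)
  then have e: "0 < e" using \<delta> by (simp add: e_def)
  have ball: "s *\<^sub>R w \<in> ball 0 \<delta>" if "\<bar>s\<bar> < e" for s
  proof -
    have "\<bar>s\<bar> * (norm w + 1) < \<delta>" using that w1 by (simp add: e_def pos_less_divide_eq)
    moreover have "\<bar>s\<bar> * norm w \<le> \<bar>s\<bar> * (norm w + 1)" by (intro mult_left_mono) auto
    ultimately show ?thesis by simp
  qed
  let ?q = "\<lambda>s. dird f (1, 0) (\<tau>, s *\<^sub>R w) /\<^sub>R s\<^sup>2"
  let ?E1 = "\<lambda>s. dird f (0, (1, 0)) (\<tau>, s *\<^sub>R w) /\<^sub>R s"
  let ?E2 = "\<lambda>s. dird f (0, (0, 1)) (\<tau>, s *\<^sub>R w) /\<^sub>R s"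
  let ?\<rho> = "\<lambda>r s. r (s *\<^sub>R w) / s\<^sup>2"
  \<comment> \<open>The left side of \<open>hom\<close> on the ray, minus its terms of order 0 and
    1, divided by \<open>s\<^sup>2\<close>, and grouped so that every factor has a limit.\<close>
  let ?R = "\<lambda>s. (\<alpha> * w1\<^sup>2 + ?\<rho> r0 s) *\<^sub>R F u
      + (s * (\<alpha> * w1\<^sup>2) + s * ?\<rho> r0 s - w1) *\<^sub>R p'
      + (1 - s * w1 + s * s * (\<alpha> * w1\<^sup>2 + ?\<rho> r0 s)) *\<^sub>R ?q s
      + (w1 * w2 + ?\<rho> r1 s) *\<^sub>R V1
      + (w2 + s * (w1 * w2 + ?\<rho> r1 s)) *\<^sub>R ?E1 s
      + (a * w1\<^sup>2 + b * (w1 * w2) + ?\<rho> r2 s) *\<^sub>R (V2 + s *\<^sub>R ?E2 s)"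
  have \<rho>: "(?\<rho> r \<longlongrightarrow> 0) (at 0)" if "r \<in> {r0, r1, r2}" for r using r[OF that] by (simp add: w)
  \<comment> \<open>The zeros stay unsimplified so that the limit matches \<open>?R\<close> factor
    by factor.\<close>
  have limR: "(?R \<longlongrightarrow> (\<alpha> * w1\<^sup>2 + 0) *\<^sub>R F u
      + (0 * (\<alpha> * w1\<^sup>2) + 0 * 0 - w1) *\<^sub>R p'
      + (1 - 0 * w1 + 0 * 0 * (\<alpha> * w1\<^sup>2 + 0)) *\<^sub>R (dird (dird (dird f (0, w)) (0, w)) (1, 0) (\<tau>, 0) /\<^sub>R 2)
      + (w1 * w2 + 0) *\<^sub>R V1
      + (w2 + 0 * (w1 * w2 + 0)) *\<^sub>R dird (dird f (0, (1, 0))) (0, w) (\<tau>, 0)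
      + (a * w1\<^sup>2 + b * (w1 * w2) + 0) *\<^sub>R (V2 + 0 *\<^sub>R dird (dird f (0, (0, 1))) (0, w) (\<tau>, 0))) (at 0)"
    by (intro tendsto_intros \<rho> ex(4) ex(5)) auto
  have limF: "((\<lambda>s. (F (u + s *\<^sub>R p + g s) - F u - s *\<^sub>R dird F p u) /\<^sub>R s\<^sup>2) \<longlongrightarrow>
    (dird (dird F p) p u + dird F (dird (dird f (0, w)) (0, w) (\<tau>, 0)) u) /\<^sub>R 2) (at 0)"
  proof (rule composition_second_order_tendsto[OF F e, where g' = "\<lambda>s. dird f (0, w) (\<tau>, s *\<^sub>R w)"])
    fix s assume "\<bar>s\<bar> < e"
    then have "f differentiable at (\<tau>, s *\<^sub>R w)"
      using C_on_differentiable[of 2 f "UNIV \<times> ball 0 \<delta>" "(\<tau>, s *\<^sub>R w)"] f ball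
      by (simp add: numeral_3_eq_3 numeral_2_eq_2)
    then show "(g has_vector_derivative dird f (0, w) (\<tau>, s *\<^sub>R w)) (at s)"
      unfolding g_def
      by (rule dird_has_vector_derivative[where c = "\<lambda>s. (\<tau>, s *\<^sub>R w)"])
        (auto intro!: derivative_eq_intros has_vector_derivative_Pair)
  qed (use ex(2) in \<open>auto simp: g_def f0 df0\<close>)
  have ev: "\<forall>\<^sub>F s in at 0. ?R s = (F (u + s *\<^sub>R p + g s) - F u - s *\<^sub>R dird F p u) /\<^sub>R s\<^sup>2"
  proof -
    have "\<forall>\<^sub>F s in at 0. \<bar>s\<bar> < e" using e by (auto simp: eventually_at intro!: exI[of _ e])
    moreover have "\<forall>\<^sub>F s in at (0::real). s \<noteq> 0" by (auto simp: eventually_at intro!: exI[of _ 1])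
    ultimately show ?thesis
    proof eventually_elim
      fix s :: real assume s: "\<bar>s\<bar> < e" "s \<noteq> 0"
      have sw: "s *\<^sub>R w = (s * w1, s * w2)" by (simp add: w)
      have ss: "s * s * (inverse s * inverse s) = 1" using s by (simp add: field_simps)
      \<comment> \<open>Naming the quotients clears the denominators, so that the comparison becomes
        an identity of polynomials in \<open>s\<close> with vector coefficients.\<close>
      define q E1 E2 \<rho>0 \<rho>1 \<rho>2 where defs: "q = ?q s" "E1 = ?E1 s" "E2 = ?E2 s"
        "\<rho>0 = ?\<rho> r0 s" "\<rho>1 = ?\<rho> r1 s" "\<rho>2 = ?\<rho> r2 s"
      have eqs: "dird f (1, 0) (\<tau>, (s * w1, s * w2)) = (s * s) *\<^sub>R q"
        "dird f (0, (1, 0)) (\<tau>, (s * w1, s * w2)) = s *\<^sub>R E1"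
        "dird f (0, (0, 1)) (\<tau>, (s * w1, s * w2)) = s *\<^sub>R E2"
        "r0 (s * w1, s * w2) = s * s * \<rho>0" "r1 (s * w1, s * w2) = s * s * \<rho>1" "r2 (s * w1, s * w2) = s * s * \<rho>2"
        using s by (simp_all add: defs sw power2_eq_square ss)
      have "F (u + s *\<^sub>R p + g s) = F (u + (s * w1) *\<^sub>R V1 + (s * w2) *\<^sub>R V2 + f (\<tau>, (s * w1, s * w2)))"
        by (simp add: g_def sw p scaleR_add_right algebra_simps)
      also have "\<dots> = (1 - s * w1 + \<alpha> * (s * w1)\<^sup>2 + s * s * \<rho>0) *\<^sub>R (F u + (s * w1) *\<^sub>R V1' + (s * w2) *\<^sub>R V2')
        + (s * w2 + (s * w1) * (s * w2) + s * s * \<rho>1) *\<^sub>R V1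
        + (a * (s * w1)\<^sup>2 + b * ((s * w1) * (s * w2)) + s * s * \<rho>2) *\<^sub>R V2
        + (1 - s * w1 + \<alpha> * (s * w1)\<^sup>2 + s * s * \<rho>0) *\<^sub>R ((s * s) *\<^sub>R q)
        + (s * w2 + (s * w1) * (s * w2) + s * s * \<rho>1) *\<^sub>R (s *\<^sub>R E1)
        + (a * (s * w1)\<^sup>2 + b * ((s * w1) * (s * w2)) + s * s * \<rho>2) *\<^sub>R (s *\<^sub>R E2)"
        using hom[of "s * w1" "s * w2", OF _ refl refl refl, symmetric] ball[OF s(1)] by (simp only: eqs sw)
      finally have "F (u + s *\<^sub>R p + g s) - F u - s *\<^sub>R dird F p u = (s * s) *\<^sub>R
        ((\<alpha> * w1\<^sup>2 + \<rho>0) *\<^sub>R F u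
        + (s * (\<alpha> * w1\<^sup>2) + s * \<rho>0 - w1) *\<^sub>R p'
        + (1 - s * w1 + s * s * (\<alpha> * w1\<^sup>2 + \<rho>0)) *\<^sub>R q
        + (w1 * w2 + \<rho>1) *\<^sub>R V1
        + (w2 + s * (w1 * w2 + \<rho>1)) *\<^sub>R E1
        + (a * w1\<^sup>2 + b * (w1 * w2) + \<rho>2) *\<^sub>R (V2 + s *\<^sub>R E2))"
        unfolding lin p' by (simp add: algebra_simps power2_eq_square)
      then show "?R s = (F (u + s *\<^sub>R p + g s) - F u - s *\<^sub>R dird F p u) /\<^sub>R s\<^sup>2"
        unfolding defs[symmetric] using ss by (simp add: power2_eq_square mult.commute[of "inverse s * inverse s"])
    qed
  qed
  have "(dird (dird F p) p u + dird F (dird (dird f (0, w)) (0, w) (\<tau>, 0)) u) /\<^sub>R 2 =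
     (\<alpha> * w1\<^sup>2 + 0) *\<^sub>R F u
      + (0 * (\<alpha> * w1\<^sup>2) + 0 * 0 - w1) *\<^sub>R p'
      + (1 - 0 * w1 + 0 * 0 * (\<alpha> * w1\<^sup>2 + 0)) *\<^sub>R (dird (dird (dird f (0, w)) (0, w)) (1, 0) (\<tau>, 0) /\<^sub>R 2)
      + (w1 * w2 + 0) *\<^sub>R V1
      + (w2 + 0 * (w1 * w2 + 0)) *\<^sub>R dird (dird f (0, (1, 0))) (0, w) (\<tau>, 0)
      + (a * w1\<^sup>2 + b * (w1 * w2) + 0) *\<^sub>R (V2 + 0 *\<^sub>R dird (dird f (0, (0, 1))) (0, w) (\<tau>, 0))"
    by (rule tendsto_unique[OF at_neq_bot limF Lim_transform_eventually[OF limR ev]])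
  then show ?thesis by (simp add: algebra_simps)
qed

section \<open>Consequences of cubic remainder bounds\<close>

lemma bigo_cube_imp_quotient_tendsto:
  fixes r :: "'a::real_normed_vector \<Rightarrow> real"
  assumes "r \<in> O[nhds 0](\<lambda>\<xi>. norm \<xi> ^ 3)"
  shows "((\<lambda>s. r (s *\<^sub>R w) / s\<^sup>2) \<longlongrightarrow> 0) (at 0)"
proof -
  obtain c where c: "\<forall>\<^sub>F \<xi> in nhds 0. norm (r \<xi>) \<le> c * norm (norm \<xi> ^ 3)"
    using landau_o.bigE[OF assms] by blast
  have "((\<lambda>s. s *\<^sub>R w) \<longlongrightarrow> 0 *\<^sub>R w) (at 0)" by (intro tendsto_intros)
  then have "filterlim (\<lambda>s. s *\<^sub>R w) (nhds 0) (at 0)" by simp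
  from eventually_compose_filterlim[OF c this]
  have ev: "\<forall>\<^sub>F s in at 0. norm (r (s *\<^sub>R w) / s\<^sup>2) \<le> \<bar>s\<bar> * (c * norm w ^ 3)"
  proof eventually_elim
    case (elim s)
    also have "c * norm (norm (s *\<^sub>R w) ^ 3) = \<bar>s\<bar> * (c * norm w ^ 3) * s\<^sup>2"
      by (simp add: power_mult_distrib power2_eq_square power3_eq_cube)
    finally show ?case by (cases "s = 0") (simp_all add: pos_divide_le_eq)
  qed
  have "((\<lambda>s. \<bar>s\<bar> * (c * norm w ^ 3)) \<longlongrightarrow> \<bar>0\<bar> * (c * norm w ^ 3)) (at 0)"
    by (intro tendsto_intros)
  then show ?thesis using ev by (intro Lim_null_comparison[OF ev]) simp
qed

text \<open>Both the quadratic form and the cubic remainder have derivative zero at the origin. This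
  supplies the flatness of H in the \<xi>-directions.\<close>

lemma quadratic_plus_cubic_is_flat:
  fixes h :: "real \<times> real \<Rightarrow> 'b::real_normed_vector"
  assumes O: "(\<lambda>\<xi>. norm (h \<xi> - ((fst \<xi>)\<^sup>2 / 2) *\<^sub>R A - (fst \<xi> * snd \<xi>) *\<^sub>R B - ((snd \<xi>)\<^sup>2 / 2) *\<^sub>R C))
      \<in> O[nhds 0](\<lambda>\<xi>. norm \<xi> ^ 3)"
  shows "h 0 = 0" and "(h has_derivative (\<lambda>_. 0)) (at 0)"
proof -
  let ?q = "\<lambda>\<xi>. ((fst \<xi>)\<^sup>2 / 2) *\<^sub>R A + (fst \<xi> * snd \<xi>) *\<^sub>R B + ((snd \<xi>)\<^sup>2 / 2) *\<^sub>R C :: 'b"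
  obtain c where c: "0 < c" "\<forall>\<^sub>F \<xi> in nhds 0. norm (h \<xi> - ?q \<xi>) \<le> c * norm \<xi> ^ 3"
    using landau_o.bigE[OF O] by (auto simp: diff_diff_eq add.assoc)
  \<comment> \<open>The filter \<open>nhds 0\<close> includes the point 0 itself, where the
    quadratic form and the cubic bound both vanish.\<close>
  from eventually_nhds_x_imp_x[OF c(2)] show h0: "h 0 = 0" by simp
  have q': "(?q has_derivative (\<lambda>_. 0)) (at 0)"
    by (auto intro!: derivative_eq_intros)
  have "((\<lambda>\<xi>. h \<xi> - ?q \<xi>) has_derivative (\<lambda>_. 0)) (at 0)"
  proof -
    have "((\<lambda>y. norm (h y - ?q y) / norm y) \<longlongrightarrow> 0) (at 0)"
    proof (rule Lim_null_comparison)
      have "\<forall>\<^sub>F \<xi> in at 0. norm (h \<xi> - ?q \<xi>) \<le> c * norm \<xi> ^ 3"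
        using c(2) by (simp add: eventually_at_filter eventually_mono)
      then show "\<forall>\<^sub>F \<xi> in at 0. norm (norm (h \<xi> - ?q \<xi>) / norm \<xi>) \<le> c * norm \<xi> ^ 2"
      proof eventually_elim
        case (elim \<xi>)
        then show ?case
          by (cases "\<xi> = 0") (simp_all add: pos_divide_le_eq power2_eq_square power3_eq_cube mult.assoc)
      qed
      have "((\<lambda>\<xi>. c * norm \<xi> ^ 2) \<longlongrightarrow> c * norm (0 :: real \<times> real) ^ 2) (at (0 :: real \<times> real))"
        by (intro tendsto_intros)
      then show "((\<lambda>\<xi>. c * norm \<xi> ^ 2) \<longlongrightarrow> 0) (at (0 :: real \<times> real))" by simp
    qed
    then show ?thesis by (simp add: has_derivative_iff_norm h0)
  qed
  from has_derivative_add[OF this q'] show "(h has_derivative (\<lambda>_. 0)) (at 0)" by simp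
qed

text \<open>The restricted system is read as an autonomous vector field \<open>V\<close> on the
  space of (\<tau>, \<xi>1, \<xi>2), and the parametrization as the map \<open>\<Phi>\<close>. The
  remainders are \<open>C_on 1\<close>, which gives \<open>V\<close> the regularity required by
  \<open>invariance_imp_homological_equation\<close>.\<close>

lemma R1_homological_equation:
  fixes F :: "'n::euclidean_space \<Rightarrow> 'n" and H :: "real \<Rightarrow> real \<times> real \<Rightarrow> 'n"
    and r0 r1 r2 :: "real \<Rightarrow> real \<times> real \<Rightarrow> real" and u0 v1 v2 :: "real \<Rightarrow> 'n"
  defines "f \<equiv> \<lambda>(\<tau>, \<xi>). H \<tau> \<xi>"
  assumes f: "\<And>x. x \<in> UNIV \<times> ball 0 \<delta> \<Longrightarrow> f differentiable at x"
    and r: "\<forall>r\<in>{r0, r1, r2}. C_on 1 (\<lambda>(\<tau>, \<xi>). r \<tau> \<xi>) (UNIV \<times> ball 0 \<delta>)"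
    and inv: "\<forall>p q (\<tau> :: real \<Rightarrow> real) (\<xi>1 :: real \<Rightarrow> real) (\<xi>2 :: real \<Rightarrow> real).
           (\<forall>t\<in>{p<..<q}.
              (\<xi>1 t, \<xi>2 t) \<in> ball 0 \<delta> \<and>
              (\<tau> has_real_derivative
                 1 - \<xi>1 t + \<alpha> * (\<xi>1 t)\<^sup>2 + r0 (\<tau> t) (\<xi>1 t, \<xi>2 t)) (at t) \<and>
              (\<xi>1 has_real_derivative
                 \<xi>2 t + \<xi>1 t * \<xi>2 t + r1 (\<tau> t) (\<xi>1 t, \<xi>2 t)) (at t) \<and>
              (\<xi>2 has_real_derivative
                 a * (\<xi>1 t)\<^sup>2 + b * (\<xi>1 t * \<xi>2 t) + r2 (\<tau> t) (\<xi>1 t, \<xi>2 t)) (at t))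
           \<longrightarrow>
           (let u = (\<lambda>t. u0 (\<tau> t) + \<xi>1 t *\<^sub>R v1 (\<tau> t) + \<xi>2 t *\<^sub>R v2 (\<tau> t)
                          + H (\<tau> t) (\<xi>1 t, \<xi>2 t))
            in \<forall>t\<in>{p<..<q}. (u has_vector_derivative F (u t)) (at t))"
    and u0: "(u0 has_vector_derivative U') (at \<tau>)"
    and v1: "(v1 has_vector_derivative V1') (at \<tau>)"
    and v2: "(v2 has_vector_derivative V2') (at \<tau>)"
    and xy: "(x, y) \<in> ball 0 \<delta>"
    and \<theta>: "\<theta> = 1 - x + \<alpha> * x\<^sup>2 + r0 \<tau> (x, y)"
    and X1: "X1 = y + x * y + r1 \<tau> (x, y)"
    and X2: "X2 = a * x\<^sup>2 + b * (x * y) + r2 \<tau> (x, y)"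
  shows "\<theta> *\<^sub>R (U' + x *\<^sub>R V1' + y *\<^sub>R V2') + X1 *\<^sub>R v1 \<tau> + X2 *\<^sub>R v2 \<tau> + \<theta> *\<^sub>R dird f (1, 0) (\<tau>, (x, y))
        + X1 *\<^sub>R dird f (0, (1, 0)) (\<tau>, (x, y)) + X2 *\<^sub>R dird f (0, (0, 1)) (\<tau>, (x, y))
      = F (u0 \<tau> + x *\<^sub>R v1 \<tau> + y *\<^sub>R v2 \<tau> + H \<tau> (x, y))"
proof -
  let ?S = "UNIV \<times> ball 0 \<delta> :: (real \<times> real \<times> real) set"
  let ?z = "(\<tau>, (x, y))"
  define R0 R1 R2 where R: "R0 = (\<lambda>(\<tau>, \<xi>). r0 \<tau> \<xi>)" "R1 = (\<lambda>(\<tau>, \<xi>). r1 \<tau> \<xi>)" "R2 = (\<lambda>(\<tau>, \<xi>). r2 \<tau> \<xi>)"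
  have RC: "C_on (Suc 0) Q ?S" if "Q \<in> {R0, R1, R2}" for Q
  proof -
    have "C_on 1 R0 ?S" "C_on 1 R1 ?S" "C_on 1 R2 ?S" using r unfolding R by blast+
    then show ?thesis using that by auto
  qed
  have Rd: "(Q has_derivative frechet_derivative Q (at z)) (at z)" if "Q \<in> {R0, R1, R2}" "z \<in> ?S" for Q z
    using C_on_differentiable[OF RC that(2)] that(1) frechet_derivative_works by blast
  have Rc: "continuous_on ?S (\<lambda>z. dird Q v z)" if "Q \<in> {R0, R1, R2}" for Q v
    using C_on_dird[OF RC[OF that], of v] by simp
  define V where "V = (\<lambda>z :: real \<times> real \<times> real.
    (1 - fst (snd z) + \<alpha> * (fst (snd z))\<^sup>2 + R0 z,
     snd (snd z) + fst (snd z) * snd (snd z) + R1 z,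
     a * (fst (snd z))\<^sup>2 + b * (fst (snd z) * snd (snd z)) + R2 z))"
  define V' where "V' = (\<lambda>z v :: real \<times> real \<times> real.
    (- fst (snd v) + \<alpha> * (2 * fst (snd v) * fst (snd z)) + dird R0 v z,
     snd (snd v) + (fst (snd z) * snd (snd v) + fst (snd v) * snd (snd z)) + dird R1 v z,
     a * (2 * fst (snd v) * fst (snd z)) + b * (fst (snd z) * snd (snd v) + fst (snd v) * snd (snd z))
       + dird R2 v z))"
  define \<Phi> where "\<Phi> = (\<lambda>z :: real \<times> real \<times> real. u0 (fst z) + fst (snd z) *\<^sub>R v1 (fst z)
    + snd (snd z) *\<^sub>R v2 (fst z) + f z)"
  define \<Phi>' where "\<Phi>' = (\<lambda>v :: real \<times> real \<times> real. fst v *\<^sub>R U'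
    + (x *\<^sub>R (fst v *\<^sub>R V1') + fst (snd v) *\<^sub>R v1 \<tau>)
    + (y *\<^sub>R (fst v *\<^sub>R V2') + snd (snd v) *\<^sub>R v2 \<tau>) + dird f v ?z)"
  have z: "?z \<in> ?S" using xy by simp
  have "\<Phi>' (V ?z) = F (\<Phi> ?z)"
  proof (rule invariance_imp_homological_equation[where S = ?S and V' = V' and V = V and \<Phi> = \<Phi> and \<Phi>' = \<Phi>' and F = F])
    show "open ?S" by (intro open_Times) auto
    show "?z \<in> ?S" by (rule z)
    show "(V has_derivative V' z) (at z)" if "z \<in> ?S" for z
      unfolding V_def V'_def
      by (rule derivative_eq_intros refl Rd that | simp)+
    show "continuous_on ?S (\<lambda>z. V' z v)" for v
      unfolding V'_def by (intro continuous_intros Rc) auto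
    show "(\<Phi> has_derivative \<Phi>') (at ?z)"
    proof -
      have c: "((\<lambda>z. g (fst z)) has_derivative (\<lambda>v. fst v *\<^sub>R d)) (at ?z)"
        if "(g has_vector_derivative d) (at \<tau>)" for g :: "real \<Rightarrow> 'n" and d
      proof (rule has_derivative_compose[where f = fst and f' = fst and g = g and g' = "\<lambda>h. h *\<^sub>R d"])
        show "(fst has_derivative fst) (at ?z)" by (auto intro!: derivative_eq_intros)
        show "(g has_derivative (\<lambda>h. h *\<^sub>R d)) (at (fst ?z))"
          using that by (simp add: has_vector_derivative_def)
      qed
      have fz: "(f has_derivative frechet_derivative f (at ?z)) (at ?z)"
        using f[OF z] by (rule frechet_derivative_works[THEN iffD1])
      have x: "((\<lambda>z. fst (snd z)) has_derivative (\<lambda>v. fst (snd v))) (at ?z)"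
        and y: "((\<lambda>z. snd (snd z)) has_derivative (\<lambda>v. snd (snd v))) (at ?z)"
        by (auto intro!: derivative_eq_intros)
      show ?thesis unfolding \<Phi>_def \<Phi>'_def
        using has_derivative_add[OF has_derivative_add[OF has_derivative_add[OF c[OF u0]
          has_derivative_scaleR[OF x c[OF v1]]] has_derivative_scaleR[OF y c[OF v2]]] fz] by simp
    qed
    fix p q t and z :: "real \<Rightarrow> real \<times> real \<times> real"
    assume sol: "\<And>t. t \<in> {p<..<q} \<Longrightarrow> z t \<in> ?S \<and> (z has_vector_derivative V (z t)) (at t)"
      and t: "t \<in> {p<..<q}"
    let ?\<tau> = "\<lambda>t. fst (z t)" and ?\<xi>1 = "\<lambda>t. fst (snd (z t))" and ?\<xi>2 = "\<lambda>t. snd (snd (z t))"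
    have "\<forall>t\<in>{p<..<q}.
              (?\<xi>1 t, ?\<xi>2 t) \<in> ball 0 \<delta> \<and>
              (?\<tau> has_real_derivative
                 1 - ?\<xi>1 t + \<alpha> * (?\<xi>1 t)\<^sup>2 + r0 (?\<tau> t) (?\<xi>1 t, ?\<xi>2 t)) (at t) \<and>
              (?\<xi>1 has_real_derivative
                 ?\<xi>2 t + ?\<xi>1 t * ?\<xi>2 t + r1 (?\<tau> t) (?\<xi>1 t, ?\<xi>2 t)) (at t) \<and>
              (?\<xi>2 has_real_derivative
                 a * (?\<xi>1 t)\<^sup>2 + b * (?\<xi>1 t * ?\<xi>2 t) + r2 (?\<tau> t) (?\<xi>1 t, ?\<xi>2 t)) (at t)"
    proof (intro ballI conjI)
      fix t assume t: "t \<in> {p<..<q}"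
      note z' = conjunct2[OF sol[OF t]]
      have V: "V (z t) = (1 - ?\<xi>1 t + \<alpha> * (?\<xi>1 t)\<^sup>2 + r0 (?\<tau> t) (?\<xi>1 t, ?\<xi>2 t),
        ?\<xi>2 t + ?\<xi>1 t * ?\<xi>2 t + r1 (?\<tau> t) (?\<xi>1 t, ?\<xi>2 t),
        a * (?\<xi>1 t)\<^sup>2 + b * (?\<xi>1 t * ?\<xi>2 t) + r2 (?\<tau> t) (?\<xi>1 t, ?\<xi>2 t))"
        by (simp add: V_def R case_prod_beta)
      show "(?\<xi>1 t, ?\<xi>2 t) \<in> ball 0 \<delta>" using sol[OF t] by (cases "z t") auto
      note s' = bounded_linear.has_vector_derivative[OF bounded_linear_snd z']
      from bounded_linear.has_vector_derivative[OF bounded_linear_fst z']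
      show "(?\<tau> has_real_derivative 1 - ?\<xi>1 t + \<alpha> * (?\<xi>1 t)\<^sup>2 + r0 (?\<tau> t) (?\<xi>1 t, ?\<xi>2 t)) (at t)"
        unfolding V by (simp add: has_real_derivative_iff_has_vector_derivative)
      from bounded_linear.has_vector_derivative[OF bounded_linear_fst s']
      show "(?\<xi>1 has_real_derivative ?\<xi>2 t + ?\<xi>1 t * ?\<xi>2 t + r1 (?\<tau> t) (?\<xi>1 t, ?\<xi>2 t)) (at t)"
        unfolding V by (simp add: has_real_derivative_iff_has_vector_derivative)
      from bounded_linear.has_vector_derivative[OF bounded_linear_snd s']
      show "(?\<xi>2 has_real_derivative a * (?\<xi>1 t)\<^sup>2 + b * (?\<xi>1 t * ?\<xi>2 t) + r2 (?\<tau> t) (?\<xi>1 t, ?\<xi>2 t)) (at t)"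
        unfolding V by (simp add: has_real_derivative_iff_has_vector_derivative)
    qed
    from inv[rule_format, OF this[rule_format], unfolded Let_def, rule_format, OF _ t]
    show "((\<lambda>t. \<Phi> (z t)) has_vector_derivative F (\<Phi> (z t))) (at t)"
      by (simp add: \<Phi>_def f_def case_prod_beta)
  qed
  moreover have "V ?z = (\<theta>, X1, X2)" by (simp add: V_def R \<theta> X1 X2)
  moreover have "dird f (\<theta>, X1, X2) ?z = \<theta> *\<^sub>R dird f (1, 0) ?z + X1 *\<^sub>R dird f (0, (1, 0)) ?z
      + X2 *\<^sub>R dird f (0, (0, 1)) ?z"
  proof -
    have lin: "linear (frechet_derivative f (at ?z))" by (rule linear_frechet_derivative[OF f[OF z]])
    have "(\<theta>, X1, X2) = \<theta> *\<^sub>R (1, 0) + X1 *\<^sub>R (0, (1, 0)) + X2 *\<^sub>R (0, (0, 1))"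
      by (simp add: zero_prod_def)
    then show ?thesis by (simp only: linear_add[OF lin] linear_scale[OF lin])
  qed
  ultimately show ?thesis
    by (simp add: \<Phi>_def \<Phi>'_def f_def algebra_simps)
qed

section \<open>Jacobian, Hessian and the periodic equations for the quadratic coefficients\<close>

lemma dird_eq_Jac_mult:
  fixes F :: "real^'n \<Rightarrow> real^'n"
  assumes "F differentiable at (u0 \<tau>)"
  shows "dird F p (u0 \<tau>) = Jac F u0 \<tau> *v p"
  unfolding Jac_def using assms jacobian_works frechet_derivative_at by metis

text \<open>Linearity in the second argument is that of a derivative, and symmetry of second
  derivatives transfers it to the first.\<close>

lemma bilinear_Hess:
  fixes F :: "real^'n \<Rightarrow> real^'n"
  assumes F: "C_on (Suc (Suc k)) F UNIV"
  shows "Hess F u0 \<tau> q p = Hess F u0 \<tau> p q"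
    and "bilinear (Hess F u0 \<tau>)"
proof -
  show sym: "Hess F u0 \<tau> q p = Hess F u0 \<tau> p q" for p q
    unfolding Hess_def by (rule C_on_2_mixed_derivatives_commute[OF F]) auto
  have "linear (Hess F u0 \<tau> p)" for p
    unfolding Hess_def using linear_frechet_derivative[OF C_on_differentiable[OF C_on_dird[OF F]]]
    by (simp add: eta_contract_eq)
  then show "bilinear (Hess F u0 \<tau>)"
    unfolding bilinear_def using sym by (metis (no_types, lifting) ext)
qed

text \<open>Along \<xi> the derivative vanishes by the cubic bound, along \<tau> because
  \<open>f\<close> is zero on the whole cycle. Joint differentiability combines the two, so the
  bound may hold for each \<tau> separately.\<close>

lemma flat_of_quadratic_expansion:
  fixes H :: "real \<Rightarrow> real \<times> real \<Rightarrow> 'b::real_normed_vector"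
  defines "f \<equiv> \<lambda>(\<tau>, \<xi>). H \<tau> \<xi>"
  assumes O: "\<forall>\<tau>. (\<lambda>\<xi>. norm (H \<tau> \<xi> - ((fst \<xi>)\<^sup>2 / 2) *\<^sub>R A \<tau> - (fst \<xi> * snd \<xi>) *\<^sub>R B \<tau>
                 - ((snd \<xi>)\<^sup>2 / 2) *\<^sub>R C \<tau>)) \<in> O[nhds 0](\<lambda>\<xi>. norm \<xi> ^ 3)"
    and f: "\<And>\<tau>. f differentiable at (\<tau>, 0)"
  shows "f (\<tau>, 0) = 0" and "dird f v (\<tau>, 0) = 0"
proof -
  have f0: "f (\<tau>, 0) = 0" for \<tau>
    using quadratic_plus_cubic_is_flat(1)[OF O[rule_format]] by (simp add: f_def)
  then show "f (\<tau>, 0) = 0" .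
  note fd = f[of \<tau>, unfolded frechet_derivative_works]
  have lin: "linear (frechet_derivative f (at (\<tau>, 0)))" by (rule linear_frechet_derivative[OF f])
  have "((\<lambda>\<xi>. f (\<tau>, \<xi>)) has_derivative (\<lambda>h. dird f (0, h) (\<tau>, 0))) (at 0)"
    by (rule has_derivative_compose[where f = "\<lambda>\<xi>. (\<tau>, \<xi>)" and g = f, OF _ fd])
      (auto intro!: derivative_eq_intros)
  moreover have "((\<lambda>\<xi>. f (\<tau>, \<xi>)) has_derivative (\<lambda>_. 0)) (at 0)"
    using quadratic_plus_cubic_is_flat(2)[OF O[rule_format]] by (simp add: f_def)
  ultimately have 1: "dird f (0, h) (\<tau>, 0) = 0" for h
    using has_derivative_unique by (metis (no_types))
  have "((\<lambda>t. f (t, 0)) has_derivative (\<lambda>h. dird f (h, 0) (\<tau>, 0))) (at \<tau>)"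
    by (rule has_derivative_compose[where f = "\<lambda>t. (t, 0)" and g = f, OF _ fd])
      (auto intro!: derivative_eq_intros)
  moreover have "((\<lambda>t. f (t, 0)) has_derivative (\<lambda>_. 0)) (at \<tau>)" by (simp add: f0)
  ultimately have 2: "dird f (h, 0) (\<tau>, 0) = 0" for h
    using has_derivative_unique by (metis (no_types))
  have "v = (fst v, 0) + (0, snd v)" by simp
  then have "dird f v (\<tau>, 0) = dird f (fst v, 0) (\<tau>, 0) + dird f (0, snd v) (\<tau>, 0)"
    by (metis linear_add[OF lin])
  then show "dird f v (\<tau>, 0) = 0" using 1 2 by simp
qed

text \<open>The coefficients are obtained as second derivatives of H on the cycle, so that their
  differentiability in \<tau> comes from \<open>C_on 3\<close>. The two equations are conditional on
  those of \<open>v1\<close> and \<open>v2\<close> at the same \<tau>, because the boundary value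
  problems provide two-sided derivatives inside the period interval only.\<close>

lemma R1_quadratic_coefficients:
  fixes F :: "real^'n \<Rightarrow> real^'n" and u0 v1 v2 :: "real \<Rightarrow> real^'n"
  assumes F: "C_on (Suc (Suc k)) F UNIV"
    and u0: "\<And>t. (u0 has_vector_derivative F (u0 t)) (at t)"
    and cm: "R1_center_manifold F u0 T v1 v2 \<alpha> a b"
  obtains h20 h11 :: "real \<Rightarrow> real^'n" where "h20 T = h20 0" "h11 T = h11 0"
    "continuous_on UNIV h20" "continuous_on UNIV h11"
    "\<And>\<tau>. (v1 has_vector_derivative Jac F u0 \<tau> *v v1 \<tau> + F (u0 \<tau>)) (at \<tau>) \<Longrightarrow>
       (v2 has_vector_derivative Jac F u0 \<tau> *v v2 \<tau> - v1 \<tau>) (at \<tau>) \<Longrightarrow>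
       (h20 has_vector_derivative Jac F u0 \<tau> *v h20 \<tau> + Hess F u0 \<tau> (v1 \<tau>) (v1 \<tau>)
         + 2 *\<^sub>R (Jac F u0 \<tau> *v v1 \<tau>) + (2 - 2 * \<alpha>) *\<^sub>R F (u0 \<tau>) - (2 * a) *\<^sub>R v2 \<tau>) (at \<tau>) \<and>
       (h11 has_vector_derivative Jac F u0 \<tau> *v h11 \<tau> + Hess F u0 \<tau> (v1 \<tau>) (v2 \<tau>)
         + Jac F u0 \<tau> *v v2 \<tau> - 2 *\<^sub>R v1 \<tau> - h20 \<tau> - b *\<^sub>R v2 \<tau>) (at \<tau>)"
proof -
  obtain \<delta> H A20 A11 A02 r0 r1 r2 where \<delta>: "0 < \<delta>"
    and H3: "C_on 3 (\<lambda>(\<tau>, \<xi>). H \<tau> \<xi>) (UNIV \<times> ball 0 \<delta>)"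
    and HT: "\<forall>\<tau>. \<forall>\<xi>\<in>ball 0 \<delta>. H (\<tau> + T) \<xi> = H \<tau> \<xi>"
    and HO: "\<forall>\<tau>. (\<lambda>\<xi>. norm (H \<tau> \<xi>
                 - ((fst \<xi>)\<^sup>2 / 2) *\<^sub>R A20 \<tau>
                 - (fst \<xi> * snd \<xi>) *\<^sub>R A11 \<tau>
                 - ((snd \<xi>)\<^sup>2 / 2) *\<^sub>R A02 \<tau>))
              \<in> O[nhds 0](\<lambda>\<xi>. norm \<xi> ^ 3)"
    and r: "\<forall>r\<in>{r0, r1, r2}.
           C_on 1 (\<lambda>(\<tau>, \<xi>). r \<tau> \<xi>) (UNIV \<times> ball 0 \<delta>) \<and>
           (\<forall>\<tau>. \<forall>\<xi>\<in>ball 0 \<delta>. r (\<tau> + T) \<xi> = r \<tau> \<xi>) \<and>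
           (\<forall>\<tau>. r \<tau> \<in> O[nhds 0](\<lambda>\<xi>. norm \<xi> ^ 3))"
    and inv: "\<forall>p q (\<tau> :: real \<Rightarrow> real) (\<xi>1 :: real \<Rightarrow> real) (\<xi>2 :: real \<Rightarrow> real).
           (\<forall>t\<in>{p<..<q}.
              (\<xi>1 t, \<xi>2 t) \<in> ball 0 \<delta> \<and>
              (\<tau> has_real_derivative
                 1 - \<xi>1 t + \<alpha> * (\<xi>1 t)\<^sup>2 + r0 (\<tau> t) (\<xi>1 t, \<xi>2 t)) (at t) \<and>
              (\<xi>1 has_real_derivative
                 \<xi>2 t + \<xi>1 t * \<xi>2 t + r1 (\<tau> t) (\<xi>1 t, \<xi>2 t)) (at t) \<and>
              (\<xi>2 has_real_derivative
                 a * (\<xi>1 t)\<^sup>2 + b * (\<xi>1 t * \<xi>2 t) + r2 (\<tau> t) (\<xi>1 t, \<xi>2 t)) (at t))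
           \<longrightarrow>
           (let u = (\<lambda>t. u0 (\<tau> t) + \<xi>1 t *\<^sub>R v1 (\<tau> t) + \<xi>2 t *\<^sub>R v2 (\<tau> t)
                          + H (\<tau> t) (\<xi>1 t, \<xi>2 t))
            in \<forall>t\<in>{p<..<q}. (u has_vector_derivative F (u t)) (at t))"
    using cm unfolding R1_center_manifold_def by (elim conjE exE) (rule that)
  define f where "f = (\<lambda>(\<tau>, \<xi>). H \<tau> \<xi>)"
  let ?S = "UNIV \<times> ball 0 \<delta> :: (real \<times> real \<times> real) set"
  have f3: "C_on 3 f ?S" using H3 by (simp add: f_def)
  then have f2: "C_on (Suc (Suc 0)) (dird f v) ?S" for v
    using C_on_dird[of "Suc (Suc 0)" f ?S] by (simp add: numeral_3_eq_3)
  have S: "(\<tau>, 0) \<in> ?S" for \<tau> using \<delta> by simp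
  have fd: "f differentiable at x" if "x \<in> ?S" for x
    using C_on_differentiable[of "Suc (Suc 0)" f ?S] f3 that by (simp add: numeral_3_eq_3)
  have r1C: "\<forall>r\<in>{r0, r1, r2}. C_on 1 (\<lambda>(\<tau>, \<xi>). r \<tau> \<xi>) ?S" using r by blast
  note flat = flat_of_quadratic_expansion[OF HO, folded f_def, OF fd[OF S]]
  define K where "K = (\<lambda>w \<tau>. dird (dird f (0, w)) (0, w) (\<tau>, 0))"
  define K' where "K' = (\<lambda>w \<tau>. dird (dird (dird f (0, w)) (0, w)) (1, 0) (\<tau>, 0))"
  have ex1: "(K w has_vector_derivative K' w \<tau>) (at \<tau>)" for w \<tau>
    using flat_quadratic_expansion(1)[OF f3 \<delta> flat, of w \<tau>] by (simp add: K_def K'_def)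
  have ex3: "((\<lambda>s. f (\<tau>, s *\<^sub>R w) /\<^sub>R s\<^sup>2) \<longlongrightarrow> K w \<tau> /\<^sub>R 2) (at 0)" for w \<tau>
    using flat_quadratic_expansion(3)[OF f3 \<delta> flat, of \<tau> w] by (simp add: K_def)
  have Kc: "continuous_on UNIV (K w)" for w
    using ex1 has_vector_derivative_continuous continuous_at_imp_continuous_on by blast
  \<comment> \<open>By periodicity of H, \<open>K w 0\<close> and \<open>K w T\<close> are limits of
    the same quotients.\<close>
  have KT: "K w T = K w 0" for w
  proof -
    have "((\<lambda>s. s *\<^sub>R w) \<longlongrightarrow> 0 *\<^sub>R w) (at 0)" by (intro tendsto_intros)
    then have "\<forall>\<^sub>F s in at 0. s *\<^sub>R w \<in> ball 0 \<delta>"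
      using \<delta> by (intro topological_tendstoD[of _ "0 *\<^sub>R w"]) auto
    then have "\<forall>\<^sub>F s in at 0. f (0, s *\<^sub>R w) /\<^sub>R s\<^sup>2 = f (T, s *\<^sub>R w) /\<^sub>R s\<^sup>2"
    proof eventually_elim
      case (elim s)
      then have "H (0 + T) (s *\<^sub>R w) = H 0 (s *\<^sub>R w)" using HT by blast
      then show ?case by (simp add: f_def)
    qed
    from tendsto_unique[OF at_neq_bot ex3[of T w] Lim_transform_eventually[OF ex3[of 0 w] this]]
    show ?thesis by simp
  qed
  define h20 where "h20 = K (1, 0)"
  \<comment> \<open>polarization: \<open>K (1, \<plusminus>1) = h20 \<plusminus> 2 h11 + h02\<close>\<close>
  define h11 where "h11 = (\<lambda>\<tau>. (1 / 4) *\<^sub>R (K (1, 1) \<tau> - K (1, -1) \<tau>))"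
  have h11': "(h11 has_vector_derivative (1 / 4) *\<^sub>R (K' (1, 1) \<tau> - K' (1, -1) \<tau>)) (at \<tau>)" for \<tau>
    unfolding h11_def by (auto intro!: derivative_eq_intros ex1)
  show thesis
  proof (rule that[of h20 h11])
    show "h20 T = h20 0" "h11 T = h11 0" by (simp_all add: h20_def h11_def KT)
    show "continuous_on UNIV h20" "continuous_on UNIV h11"
      unfolding h20_def h11_def by (intro continuous_intros Kc)+
    fix \<tau>
    let ?A = "Jac F u0 \<tau>" and ?B = "Hess F u0 \<tau>" and ?V1 = "v1 \<tau>" and ?V2 = "v2 \<tau>" and ?f = "F (u0 \<tau>)"
    assume v1: "(v1 has_vector_derivative ?A *v ?V1 + ?f) (at \<tau>)"
      and v2: "(v2 has_vector_derivative ?A *v ?V2 - ?V1) (at \<tau>)"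
    have A: "dird F p (u0 \<tau>) = ?A *v p" for p
      by (rule dird_eq_Jac_mult) (use C_on_differentiable[OF F] in auto)
    \<comment> \<open>The mixed derivative in the directions (1, 0) and \<open>w\<close>; for
      \<open>w = (w1, w2)\<close> it amounts to \<open>w1\<close> times h20 plus \<open>w2\<close>
      times h11.\<close>
    let ?L = "\<lambda>w. dird (dird f (0, (1, 0))) (0, w) (\<tau>, 0)"
    have bal: "(?B p p + ?A *v K (w1, w2) \<tau>) /\<^sub>R 2 =
        (\<alpha> * w1\<^sup>2) *\<^sub>R ?f - w1 *\<^sub>R (w1 *\<^sub>R (?A *v ?V1 + ?f) + w2 *\<^sub>R (?A *v ?V2 - ?V1)) + K' (w1, w2) \<tau> /\<^sub>R 2
        + (w1 * w2) *\<^sub>R ?V1 + w2 *\<^sub>R ?L (w1, w2) + (a * w1\<^sup>2 + b * (w1 * w2)) *\<^sub>R ?V2"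
      if p: "p = w1 *\<^sub>R ?V1 + w2 *\<^sub>R ?V2" for p w1 w2
    proof -
      have "(dird (dird F p) p (u0 \<tau>) + dird F (dird (dird f (0, (w1, w2))) (0, (w1, w2)) (\<tau>, 0)) (u0 \<tau>)) /\<^sub>R 2 =
        (\<alpha> * w1\<^sup>2) *\<^sub>R ?f - w1 *\<^sub>R (w1 *\<^sub>R (?A *v ?V1 + ?f) + w2 *\<^sub>R (?A *v ?V2 - ?V1))
        + dird (dird (dird f (0, (w1, w2))) (0, (w1, w2))) (1, 0) (\<tau>, 0) /\<^sub>R 2
        + (w1 * w2) *\<^sub>R ?V1 + w2 *\<^sub>R ?L (w1, w2) + (a * w1\<^sup>2 + b * (w1 * w2)) *\<^sub>R ?V2"
      proof (rule R1_second_order_balance[OF F f3 \<delta> flat _ _ p refl _ refl,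
            where ?r0.0 = "r0 \<tau>" and ?r1.0 = "r1 \<tau>" and ?r2.0 = "r2 \<tau>"])
        fix Q assume "Q \<in> {r0 \<tau>, r1 \<tau>, r2 \<tau>}"
        then have "Q \<in> O[nhds 0](\<lambda>\<xi>. norm \<xi> ^ 3)" using r by auto
        then show "((\<lambda>s. Q (s *\<^sub>R (w1, w2)) / s\<^sup>2) \<longlongrightarrow> 0) (at 0)" by (rule bigo_cube_imp_quotient_tendsto)
      next
        fix \<theta> X1 X2 x y
        assume "(x, y) \<in> ball 0 \<delta>" "\<theta> = 1 - x + \<alpha> * x\<^sup>2 + r0 \<tau> (x, y)" "X1 = y + x * y + r1 \<tau> (x, y)"
          "X2 = a * x\<^sup>2 + b * (x * y) + r2 \<tau> (x, y)"
        from R1_homological_equation[OF _ r1C inv u0 v1 v2 this, folded f_def, OF fd]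
        show "\<theta> *\<^sub>R (?f + x *\<^sub>R (?A *v ?V1 + ?f) + y *\<^sub>R (?A *v ?V2 - ?V1)) + X1 *\<^sub>R ?V1 + X2 *\<^sub>R ?V2
          + \<theta> *\<^sub>R dird f (1, 0) (\<tau>, (x, y)) + X1 *\<^sub>R dird f (0, (1, 0)) (\<tau>, (x, y))
          + X2 *\<^sub>R dird f (0, (0, 1)) (\<tau>, (x, y))
          = F (u0 \<tau> + x *\<^sub>R ?V1 + y *\<^sub>R ?V2 + f (\<tau>, (x, y)))"
          by (simp add: f_def)
      next
        show "dird F p (u0 \<tau>) = w1 *\<^sub>R (?A *v ?V1 + ?f) + w2 *\<^sub>R (?A *v ?V2 - ?V1) - w1 *\<^sub>R ?f + w2 *\<^sub>R ?V1"
          unfolding A p by (simp add: matrix_vector_right_distrib matrix_vector_mult_scaleR algebra_simps)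
      qed
      then show ?thesis by (simp add: K_def K'_def Hess_def A)
    qed
    have "K' (1, 0) \<tau> = ?A *v h20 \<tau> + ?B ?V1 ?V1 + 2 *\<^sub>R (?A *v ?V1) + (2 - 2 * \<alpha>) *\<^sub>R ?f - (2 * a) *\<^sub>R ?V2"
    proof -
      have "(?B ?V1 ?V1 + ?A *v h20 \<tau>) /\<^sub>R 2 = \<alpha> *\<^sub>R ?f - (?A *v ?V1 + ?f) + K' (1, 0) \<tau> /\<^sub>R 2 + a *\<^sub>R ?V2"
        using bal[of ?V1 1 0] by (simp add: h20_def)
      then have "2 *\<^sub>R ((?B ?V1 ?V1 + ?A *v h20 \<tau>) /\<^sub>R 2) =
          2 *\<^sub>R (\<alpha> *\<^sub>R ?f - (?A *v ?V1 + ?f) + K' (1, 0) \<tau> /\<^sub>R 2 + a *\<^sub>R ?V2)" by (rule arg_cong)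
      then show ?thesis by (simp add: algebra_simps)
    qed
    moreover have "(1 / 4) *\<^sub>R (K' (1, 1) \<tau> - K' (1, -1) \<tau>) = ?A *v h11 \<tau> + ?B ?V1 ?V2
         + ?A *v ?V2 - 2 *\<^sub>R ?V1 - h20 \<tau> - b *\<^sub>R ?V2"
    proof -
      \<comment> \<open>On the sum of the two rays (1, 1) and (1, -1) the h11 parts cancel. This is
        how h20 enters the equation of h11.\<close>
      have L: "?L (1, 1) + ?L (1, -1) = 2 *\<^sub>R h20 \<tau>"
      proof -
        have lin: "linear (frechet_derivative (dird f (0, (1, 0))) (at (\<tau>, 0)))"
          by (rule linear_frechet_derivative[OF C_on_differentiable[OF f2 S]])
        have "?L (1, 1) + ?L (1, -1) = dird (dird f (0, (1, 0))) (2 *\<^sub>R (0, (1, 0))) (\<tau>, 0)"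
          by (simp flip: linear_add[OF lin])
        then show ?thesis by (simp only: linear_scale[OF lin] h20_def K_def)
      qed
      have bil: "bilinear ?B" and sym: "?B ?V2 ?V1 = ?B ?V1 ?V2" by (rule bilinear_Hess[OF F])+
      have B: "?B (?V1 + ?V2) (?V1 + ?V2) - ?B (?V1 - ?V2) (?V1 - ?V2) = 4 *\<^sub>R ?B ?V1 ?V2"
        by (simp add: bilinear_ladd[OF bil] bilinear_radd[OF bil] bilinear_lsub[OF bil] bilinear_rsub[OF bil] sym) (simp add: vec_eq_iff)
      let ?P = "?B (?V1 + ?V2) (?V1 + ?V2)" and ?M = "?B (?V1 - ?V2) (?V1 - ?V2)"
      have p: "(?P + ?A *v K (1, 1) \<tau>) /\<^sub>R 2 = \<alpha> *\<^sub>R ?f - ((?A *v ?V1 + ?f) + (?A *v ?V2 - ?V1)) + K' (1, 1) \<tau> /\<^sub>R 2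
          + ?V1 + ?L (1, 1) + (a + b) *\<^sub>R ?V2"
        using bal[of "?V1 + ?V2" 1 1] by simp
      have m: "(?M + ?A *v K (1, -1) \<tau>) /\<^sub>R 2 = \<alpha> *\<^sub>R ?f - ((?A *v ?V1 + ?f) - (?A *v ?V2 - ?V1)) + K' (1, -1) \<tau> /\<^sub>R 2
          - ?V1 - ?L (1, -1) + (a - b) *\<^sub>R ?V2"
        using bal[of "?V1 - ?V2" 1 "-1"] by simp
      \<comment> \<open>Subtracting the balances for (1, 1) and (1, -1) cancels what is even in
        \<open>w2\<close>, in particular the terms with \<alpha> and \<open>a\<close>, and doubles
        what is odd, among it the term with \<open>b\<close>. The factor \<open>w2\<close> in front
        of \<open>?L\<close> turns the difference of its values into a sum.\<close>
      have "(1 / 2) *\<^sub>R (?P - ?M) + (1 / 2) *\<^sub>R (?A *v (K (1, 1) \<tau> - K (1, -1) \<tau>)) =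
          (?P + ?A *v K (1, 1) \<tau>) /\<^sub>R 2 - (?M + ?A *v K (1, -1) \<tau>) /\<^sub>R 2"
        by (simp add: matrix_vector_mult_diff_distrib algebra_simps)
      also have "\<dots> = (1 / 2) *\<^sub>R (K' (1, 1) \<tau> - K' (1, -1) \<tau>) - 2 *\<^sub>R (?A *v ?V2) + 4 *\<^sub>R ?V1
          + (?L (1, 1) + ?L (1, -1)) + (2 * b) *\<^sub>R ?V2"
        unfolding p m by (simp add: vec_eq_iff field_simps)
      finally have "(1 / 2) *\<^sub>R ((1 / 2) *\<^sub>R (?P - ?M) + (1 / 2) *\<^sub>R (?A *v (K (1, 1) \<tau> - K (1, -1) \<tau>))) =
          (1 / 2) *\<^sub>R ((1 / 2) *\<^sub>R (K' (1, 1) \<tau> - K' (1, -1) \<tau>) - 2 *\<^sub>R (?A *v ?V2) + 4 *\<^sub>R ?V1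
          + 2 *\<^sub>R h20 \<tau> + (2 * b) *\<^sub>R ?V2)" unfolding L by (rule arg_cong)
      then have "?B ?V1 ?V2 + ?A *v h11 \<tau> = (1 / 4) *\<^sub>R (K' (1, 1) \<tau> - K' (1, -1) \<tau>) - ?A *v ?V2 + 2 *\<^sub>R ?V1
          + h20 \<tau> + b *\<^sub>R ?V2"
        unfolding B h11_def matrix_vector_mult_scaleR by (simp add: scaleR_add_right scaleR_diff_right)
      then show ?thesis by (simp add: algebra_simps)
    qed
    ultimately show "(h20 has_vector_derivative ?A *v h20 \<tau> + ?B ?V1 ?V1
         + 2 *\<^sub>R (?A *v ?V1) + (2 - 2 * \<alpha>) *\<^sub>R ?f - (2 * a) *\<^sub>R ?V2) (at \<tau>) \<and>
       (h11 has_vector_derivative ?A *v h11 \<tau> + ?B ?V1 ?V2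
         + ?A *v ?V2 - 2 *\<^sub>R ?V1 - h20 \<tau> - b *\<^sub>R ?V2) (at \<tau>)"
      using ex1[of "(1, 0)" \<tau>] h11'[of \<tau>] by (simp add: h20_def)
  qed
qed

section \<open>Solvability conditions\<close>

text \<open>In the derivative of \<open>x \<tau> \<bullet> y \<tau>\<close> the terms with
  \<open>A\<close> cancel, and periodicity makes the integral of that derivative zero. The case
  \<open>c = 0\<close> serves \<open>\<phi>s\<close>, the case \<open>c = \<phi>s\<close> serves
  \<open>v1s\<close>. For \<open>y\<close> an equation in the open interval and continuity up to the
  ends suffice, as is required for h20 and h11.\<close>

lemma adjoint_bvp_pairing:
  fixes A :: "real \<Rightarrow> real^'n^'n"
  assumes T: "0 < T"
    and x: "periodic_bvp T (\<lambda>\<tau> x. - (transpose (A \<tau>) *v x) + c \<tau>) x"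
    and y: "continuous_on {0..T} y" "y T = y 0"
      "\<And>\<tau>. \<tau> \<in> {0<..<T} \<Longrightarrow> (y has_vector_derivative A \<tau> *v y \<tau> + g \<tau>) (at \<tau>)"
  shows "((\<lambda>\<tau>. x \<tau> \<bullet> g \<tau> + c \<tau> \<bullet> y \<tau>) has_integral 0) {0..T}"
proof -
  have x': "(x has_vector_derivative - (transpose (A \<tau>) *v x \<tau>) + c \<tau>) (at \<tau> within {0..T})" if "\<tau> \<in> {0..T}" for \<tau>
    using x that by (simp add: periodic_bvp_def)
  have xc: "continuous_on {0..T} x"
    using x' has_vector_derivative_continuous continuous_on_eq_continuous_within by blast
  have "((\<lambda>\<tau>. x \<tau> \<bullet> g \<tau> + c \<tau> \<bullet> y \<tau>) has_integral (x T \<bullet> y T - x 0 \<bullet> y 0)) {0..T}"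
  proof (rule fundamental_theorem_of_calculus_interior)
    show "continuous_on {0..T} (\<lambda>\<tau>. x \<tau> \<bullet> y \<tau>)" by (intro continuous_intros xc y)
    fix \<tau> assume \<tau>: "\<tau> \<in> {0<..<T}"
    then have "(x has_vector_derivative - (transpose (A \<tau>) *v x \<tau>) + c \<tau>) (at \<tau>)"
      using x'[of \<tau>] by (simp add: at_within_interior[of \<tau> "{0..T}"])
    from bounded_bilinear.has_vector_derivative[OF bounded_bilinear_inner this y(3)[OF \<tau>]]
    have "((\<lambda>\<tau>. x \<tau> \<bullet> y \<tau>) has_vector_derivative
        x \<tau> \<bullet> (A \<tau> *v y \<tau> + g \<tau>) + (- (transpose (A \<tau>) *v x \<tau>) + c \<tau>) \<bullet> y \<tau>) (at \<tau>)" .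
    moreover have "(transpose (A \<tau>) *v x \<tau>) \<bullet> y \<tau> = x \<tau> \<bullet> (A \<tau> *v y \<tau>)"
      by (simp add: dot_lmul_matrix)
    ultimately show "((\<lambda>\<tau>. x \<tau> \<bullet> y \<tau>) has_vector_derivative x \<tau> \<bullet> g \<tau> + c \<tau> \<bullet> y \<tau>) (at \<tau>)"
      by (simp add: inner_add_left inner_add_right inner_diff_left)
  qed (use T in auto)
  then show ?thesis using x y(2) by (simp add: periodic_bvp_def)
qed

section \<open>The coefficients a and b from the solvability conditions\<close>

theorem mainTheorem4:
  fixes F :: "real^'n \<Rightarrow> real^'n"
    and u0 v1 v2 \<phi>s v1s :: "real \<Rightarrow> real^'n"
    and Y :: "real \<Rightarrow> real^'n^'n"
    and T \<alpha> a b :: real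
  defines "A \<equiv> Jac F u0" and "B \<equiv> Hess F u0"
  assumes "C_on 3 F UNIV"
    and "limit_cycle F u0 T"
    and "fundamental_solution A Y"
    and "R1_bifurcation (Y T)"
    and "periodic_bvp T (\<lambda>\<tau> y. A \<tau> *v y + F (u0 \<tau>)) v1"
    and "integral {0..T} (\<lambda>\<tau>. v1 \<tau> \<bullet> F (u0 \<tau>)) = 0"
    and "periodic_bvp T (\<lambda>\<tau> y. A \<tau> *v y - v1 \<tau>) v2"
    and "integral {0..T} (\<lambda>\<tau>. v2 \<tau> \<bullet> F (u0 \<tau>)) = 0"
    and "periodic_bvp T (\<lambda>\<tau> y. - (transpose (A \<tau>) *v y)) \<phi>s"
    and "integral {0..T} (\<lambda>\<tau>. \<phi>s \<tau> \<bullet> v2 \<tau>) = 1"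
    and "periodic_bvp T (\<lambda>\<tau> y. - (transpose (A \<tau>) *v y) + \<phi>s \<tau>) v1s"
    and "integral {0..T} (\<lambda>\<tau>. v1s \<tau> \<bullet> v2 \<tau>) = 0"
    and "R1_center_manifold F u0 T v1 v2 \<alpha> a b"
  shows "a = 1 / 2 * integral {0..T}
               (\<lambda>\<tau>. \<phi>s \<tau> \<bullet> (2 *\<^sub>R (A \<tau> *v v1 \<tau>) + B \<tau> (v1 \<tau>) (v1 \<tau>))) \<and>
         b = integral {0..T} (\<lambda>\<tau>. \<phi>s \<tau> \<bullet> (B \<tau> (v1 \<tau>) (v2 \<tau>) + A \<tau> *v v2 \<tau>)) +
             integral {0..T}
               (\<lambda>\<tau>. v1s \<tau> \<bullet> (2 *\<^sub>R (A \<tau> *v v1 \<tau>) + B \<tau> (v1 \<tau>) (v1 \<tau>)))"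
proof -
  have F: "C_on (Suc (Suc (Suc 0))) F UNIV" using assms(3) by (simp add: numeral_3_eq_3)
  have T: "0 < T" and u0: "\<And>t. (u0 has_vector_derivative F (u0 t)) (at t)"
    using \<open>limit_cycle F u0 T\<close> by (auto simp: limit_cycle_def)
  obtain h20 h11 where per: "h20 T = h20 0" "h11 T = h11 0"
    and cont: "continuous_on UNIV h20" "continuous_on UNIV h11"
    and h: "\<And>\<tau>. (v1 has_vector_derivative A \<tau> *v v1 \<tau> + F (u0 \<tau>)) (at \<tau>) \<Longrightarrow>
       (v2 has_vector_derivative A \<tau> *v v2 \<tau> - v1 \<tau>) (at \<tau>) \<Longrightarrow>
       (h20 has_vector_derivative A \<tau> *v h20 \<tau> + B \<tau> (v1 \<tau>) (v1 \<tau>)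
         + 2 *\<^sub>R (A \<tau> *v v1 \<tau>) + (2 - 2 * \<alpha>) *\<^sub>R F (u0 \<tau>) - (2 * a) *\<^sub>R v2 \<tau>) (at \<tau>) \<and>
       (h11 has_vector_derivative A \<tau> *v h11 \<tau> + B \<tau> (v1 \<tau>) (v2 \<tau>)
         + A \<tau> *v v2 \<tau> - 2 *\<^sub>R v1 \<tau> - h20 \<tau> - b *\<^sub>R v2 \<tau>) (at \<tau>)"
    using R1_quadratic_coefficients[OF F u0 \<open>R1_center_manifold F u0 T v1 v2 \<alpha> a b\<close>] unfolding A_def B_def by blast
  have bvp_cont: "continuous_on {0..T} y" if "periodic_bvp T g y" for g and y :: "real \<Rightarrow> real^'n"
    using that has_vector_derivative_continuous continuous_on_eq_continuous_within
    unfolding periodic_bvp_def by blast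
  have bvp_at: "(y has_vector_derivative g \<tau> (y \<tau>)) (at \<tau>)" if "periodic_bvp T g y" "\<tau> \<in> {0<..<T}"
    for g and y :: "real \<Rightarrow> real^'n" and \<tau>
    using that by (auto simp: periodic_bvp_def at_within_interior[of \<tau> "{0..T}"] dest: bspec[of _ _ \<tau>])
  note v1 = \<open>periodic_bvp T (\<lambda>\<tau> y. A \<tau> *v y + F (u0 \<tau>)) v1\<close>
  note v2 = \<open>periodic_bvp T (\<lambda>\<tau> y. A \<tau> *v y - v1 \<tau>) v2\<close>
  note v1s = \<open>periodic_bvp T (\<lambda>\<tau> y. - (transpose (A \<tau>) *v y) + \<phi>s \<tau>) v1s\<close>
  \<comment> \<open>The added zero gives the equation the shape that the pairing lemma expects, with
    \<open>c = 0\<close>.\<close>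
  have \<phi>s: "periodic_bvp T (\<lambda>\<tau> y. - (transpose (A \<tau>) *v y) + 0) \<phi>s"
    using \<open>periodic_bvp T (\<lambda>\<tau> y. - (transpose (A \<tau>) *v y)) \<phi>s\<close> by simp
  note c = bvp_cont[OF v1] bvp_cont[OF v2] bvp_cont[OF v1s] bvp_cont[OF \<phi>s]
    continuous_on_subset[OF cont(1) subset_UNIV] continuous_on_subset[OF cont(2) subset_UNIV]
  have p: "v1 T = v1 0" "v2 T = v2 0" using v1 v2 by (auto simp: periodic_bvp_def)
  note h' = h[OF bvp_at[OF v1] bvp_at[OF v2]]
  let ?G = "\<lambda>\<tau>. B \<tau> (v1 \<tau>) (v1 \<tau>) + 2 *\<^sub>R (A \<tau> *v v1 \<tau>) + (2 - 2 * \<alpha>) *\<^sub>R F (u0 \<tau>) - (2 * a) *\<^sub>R v2 \<tau>"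
  let ?K = "\<lambda>\<tau>. B \<tau> (v1 \<tau>) (v2 \<tau>) + A \<tau> *v v2 \<tau> - 2 *\<^sub>R v1 \<tau> - h20 \<tau> - b *\<^sub>R v2 \<tau>"
  have v2': "(v2 has_vector_derivative A \<tau> *v v2 \<tau> + - v1 \<tau>) (at \<tau>)" if "\<tau> \<in> {0<..<T}" for \<tau>
    using bvp_at[OF v2 that] by simp
  have h20': "(h20 has_vector_derivative A \<tau> *v h20 \<tau> + ?G \<tau>) (at \<tau>)"
    and h11': "(h11 has_vector_derivative A \<tau> *v h11 \<tau> + ?K \<tau>) (at \<tau>)" if "\<tau> \<in> {0<..<T}" for \<tau>
    using h'[OF that that] by (simp_all add: algebra_simps)
  note pair = adjoint_bvp_pairing[OF T]
  \<comment> \<open>The orthogonality relations: \<open>\<phi>s\<close> paired with the equation of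
    \<open>v1\<close> gives this one, \<open>\<phi>s\<close> with that of \<open>v2\<close> gives
    the next, and \<open>v1s\<close> with that of \<open>v1\<close> gives \<open>IvF\<close> after
    subtraction of \<open>I\<phi>v1\<close>.\<close>
  have I\<phi>F: "((\<lambda>\<tau>. \<phi>s \<tau> \<bullet> F (u0 \<tau>)) has_integral 0) {0..T}"
    using pair[OF \<phi>s c(1) p(1) bvp_at[OF v1]] by simp
  have I\<phi>v1: "((\<lambda>\<tau>. \<phi>s \<tau> \<bullet> v1 \<tau>) has_integral 0) {0..T}"
    using has_integral_neg[OF pair[OF \<phi>s c(2) p(2) v2']] by simp
  have "((\<lambda>\<tau>. v1s \<tau> \<bullet> F (u0 \<tau>) + \<phi>s \<tau> \<bullet> v1 \<tau>) has_integral 0) {0..T}"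
    by (rule pair[OF v1s c(1) p(1) bvp_at[OF v1]])
  from has_integral_diff[OF this I\<phi>v1]
  have IvF: "((\<lambda>\<tau>. v1s \<tau> \<bullet> F (u0 \<tau>)) has_integral 0) {0..T}" by simp
  \<comment> \<open>The value of \<open>integral\<close> alone does not say that the integrand is
    integrable; continuity of both factors does.\<close>
  have I\<phi>v2: "((\<lambda>\<tau>. \<phi>s \<tau> \<bullet> v2 \<tau>) has_integral 1) {0..T}"
    using integrable_integral[OF integrable_continuous_real[OF continuous_on_inner[OF c(4) c(2)]]]
      \<open>integral {0..T} (\<lambda>\<tau>. \<phi>s \<tau> \<bullet> v2 \<tau>) = 1\<close> by simp
  have Ivv2: "((\<lambda>\<tau>. v1s \<tau> \<bullet> v2 \<tau>) has_integral 0) {0..T}"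
    using integrable_integral[OF integrable_continuous_real[OF continuous_on_inner[OF c(3) c(2)]]]
      \<open>integral {0..T} (\<lambda>\<tau>. v1s \<tau> \<bullet> v2 \<tau>) = 0\<close> by simp
  define J where "J = integral {0..T} (\<lambda>\<tau>. \<phi>s \<tau> \<bullet> h20 \<tau>)"
  have IJ: "((\<lambda>\<tau>. \<phi>s \<tau> \<bullet> h20 \<tau>) has_integral J) {0..T}"
    unfolding J_def by (intro integrable_integral integrable_continuous_real continuous_on_inner c)
  \<comment> \<open>The \<open>F (u0 \<tau>)\<close> term, and \<alpha> with it, drops out by
    orthogonality, and the normalization against \<open>v2\<close> isolates
    \<open>2 * a\<close>.\<close>
  have "((\<lambda>\<tau>. \<phi>s \<tau> \<bullet> ?G \<tau>) has_integral 0) {0..T}"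
    using pair[OF \<phi>s c(5) per(1) h20'] by simp
  from has_integral_add[OF has_integral_diff[OF this has_integral_mult_right[OF I\<phi>F, of "2 - 2 * \<alpha>"]]
      has_integral_mult_right[OF I\<phi>v2, of "2 * a"]]
  have Ia: "((\<lambda>\<tau>. \<phi>s \<tau> \<bullet> (2 *\<^sub>R (A \<tau> *v v1 \<tau>) + B \<tau> (v1 \<tau>) (v1 \<tau>))) has_integral 2 * a) {0..T}"
    by (simp add: inner_add_right inner_diff_right algebra_simps)
  have "((\<lambda>\<tau>. \<phi>s \<tau> \<bullet> ?K \<tau>) has_integral 0) {0..T}"
    using pair[OF \<phi>s c(6) per(2) h11'] by simp
  from has_integral_add[OF has_integral_add[OF has_integral_add[OF this
      has_integral_mult_right[OF I\<phi>v1, of 2]] IJ] has_integral_mult_right[OF I\<phi>v2, of b]]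
  have Ib: "((\<lambda>\<tau>. \<phi>s \<tau> \<bullet> (B \<tau> (v1 \<tau>) (v2 \<tau>) + A \<tau> *v v2 \<tau>)) has_integral J + b) {0..T}"
    by (simp add: inner_add_right inner_diff_right algebra_simps)
  \<comment> \<open>The inhomogeneity \<open>\<phi>s\<close> in the equation of \<open>v1s\<close>
    produces \<open>J\<close>, while \<open>IvF\<close> and \<open>Ivv2\<close> remove the terms
    with \<alpha> and \<open>a\<close>. Adding the result to \<open>Ib\<close> cancels
    \<open>J\<close>.\<close>
  have "((\<lambda>\<tau>. v1s \<tau> \<bullet> ?G \<tau> + \<phi>s \<tau> \<bullet> h20 \<tau>) has_integral 0) {0..T}"
    by (rule pair[OF v1s c(5) per(1) h20'])
  from has_integral_add[OF has_integral_diff[OF has_integral_diff[OF this IJ]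
      has_integral_mult_right[OF IvF, of "2 - 2 * \<alpha>"]] has_integral_mult_right[OF Ivv2, of "2 * a"]]
  have Ic: "((\<lambda>\<tau>. v1s \<tau> \<bullet> (2 *\<^sub>R (A \<tau> *v v1 \<tau>) + B \<tau> (v1 \<tau>) (v1 \<tau>))) has_integral - J) {0..T}"
    by (simp add: inner_add_right inner_diff_right algebra_simps)
  show ?thesis
    using integral_unique[OF Ia] integral_unique[OF Ib] integral_unique[OF Ic] by simp
qed

end
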